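(* Let $T$ be a completely non unitary contraction on a separable complex Hilbert space $\mathcal{H}$ whose characteristic function $\Theta_T$ is a polynomial of degree $n$. Then there exist closed subspaces $\mathcal{H}_1,\mathcal{H}_0,\mathcal{H}_{-1}$ of $\mathcal{H}$ (some possibly $\{0\}$) with $\mathcal{H}=\mathcal{H}_1\oplus\mathcal{H}_0\oplus\mathcal{H}_{-1}$ such that, with respect to this decomposition, $T$ has the matrix representation $$T=\begin{bmatrix}S&*&*\\0&N&*\\0&0&C\end{bmatrix},\qquad(\dagger)$$ where $S\in\mathcal{L}(\mathcal{H}_1)$ is a pure isometry, $N\in\mathcal{L}(\mathcal{H}_0)$ is nilpotent of order $n$ and $C\in\mathcal{L}(\mathcal{H}_{-1})$ is a pure co-isometry; in particular $S$ and $C^*$ are unilateral shifts of some multiplicities. Furthermore, in the class of all representations $(\dagger)$ with these properties there exist unique representations $$T=\begin{bmatrix}S^{(c)}&*&*\\0&N^{(c)}&*\\0&0&C^{(c)}\end{bmatrix}\ \text{on}\ \mathcal{H}=\mathcal{H}^{(c)}_1\oplus\mathcal{H}^{(c)}_0\oplus\mathcal{H}^{(c)}_{-1},\qquad T=\begin{bmatrix}S^{(c)}_*&*&*\\0&N^{(c)}_*&*\\0&0&C^{(c)}_*\end{bmatrix}\ \text{on}\ \mathcal{H}=\mathcal{H}^{(c)}_{1*}\oplus\mathcal{H}^{(c)}_{0*}\oplus\mathcal{H}^{(c)}_{-1*}$$ such that $$\mathcal{H}^{(c)}_1\subset\mathcal{H}_1,\quad \mathcal{H}^{(c)}_{-1}\supset\mathcal{H}_{-1},\qquad\text{respectively}\qquad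 \mathcal{H}^{(c)}_{1*}\supset\mathcal{H}_1,\quad\mathcal{H}^{(c)}_{-1*}\subset\mathcal{H}_{-1},$$ holds for all other representations $(\dagger)$ in the class, on $\mathcal{H}=\mathcal{H}_1\oplus\mathcal{H}_0\oplus\mathcal{H}_{-1}$. Moreover, $\mathcal{H}^{(c)}_{-1}$ (respectively $\mathcal{H}^{(c)}_{1*}$) is the maximal invariant subspace of $T^*$ (respectively of $T$) on which $T^*$ (respectively $T$) is isometric.
   Context: All Hilbert spaces are separable and complex. $\mathcal{L}(\mathcal{H})$ denotes the bounded linear operators on $\mathcal{H}$. A contraction $T$ ($\|T\|\le 1$) is completely non unitary (c.n.u.) if there is no nonzero $T$-reducing subspace on which $T$ is unitary. Put $D_T=(I-T^*T)^{1/2}$, $D_{T^*}=(I-TT^* )^{1/2}$, $\mathcal{D}_T=\overline{\mathrm{Ran}\,D_T}$, $\mathcal{D}_{T^*}=\overline{\mathrm{Ran}\,D_{T^*}}$. The characteristic function of $T$ is the $\mathcal{L}(\mathcal{D}_T,\mathcal{D}_{T^*})$-valued analytic function $\Theta_T(z)=[-T+zD_{T^*}(I-zT^* )^{-1}D_T]|_{\mathcal{D}_T}$, $z\in\mathbb{D}$. It is a polynomial of degree $n$ if it is an operator-valued polynomial of that degree; constant functions (including $0$) are of degree $0$. A matrix representation with entries $*$ means block form with unspecified entries. The order of a nilpotent operator $N$ is the smallest integer $p\ge0$ with $N^p=0$, where $N^0=I$ (so order $0$ means that the space is $\{0\}$). A pure isometry is an isometry with no unitary part, i.e. a unilateral shift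 of some multiplicity (possibly $0$); a pure co-isometry is an operator whose adjoint is a pure isometry. *)

theory Defs
  imports "HOL-Analysis.Analysis"
begin

(* Complex inner product spaces extend the library's real ones, so that norm, topology and
   completeness are the library's.  The complex inner product is linear in its first argument. *)

class complex_inner = real_inner +
  fixes scaleC :: "complex \<Rightarrow> 'a \<Rightarrow> 'a"  (infixr "*\<^sub>C" 75)
    and cinner :: "'a \<Rightarrow> 'a \<Rightarrow> complex"
  assumes scaleC_add_right: "c *\<^sub>C (x + y) = c *\<^sub>C x + c *\<^sub>C y"
    and scaleC_add_left: "(c + d) *\<^sub>C x = c *\<^sub>C x + d *\<^sub>C x"
    and scaleC_scaleC: "c *\<^sub>C (d *\<^sub>C x) = (c * d) *\<^sub>C x"
    and scaleR_scaleC: "r *\<^sub>R x = complex_of_real r *\<^sub>C x"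
    and cinner_commute: "cinner x y = cnj (cinner y x)"
    and cinner_add_left: "cinner (x + y) z = cinner x z + cinner y z"
    and cinner_scaleC_left: "cinner (c *\<^sub>C x) y = c * cinner x y"
    and inner_eq_Re_cinner: "inner x y = Re (cinner x y)"

class complex_hilbert_space = complex_inner + complete_space

global_interpretation complex_vector: vector_space "scaleC :: complex \<Rightarrow> 'a \<Rightarrow> 'a :: complex_inner"
  defines csubspace = complex_vector.subspace
    and cspan = complex_vector.span
proof unfold_locales
  fix x :: 'a
  show "1 *\<^sub>C x = x"
    using scaleR_scaleC[of 1 x] by simp
qed (simp_all add: scaleC_add_right scaleC_add_left scaleC_scaleC)

lemma norm_eq_sqrt_cinner: "norm x = sqrt (Re (cinner x x))"
  for x :: "'a::complex_inner"
  by (simp add: norm_eq_sqrt_inner inner_eq_Re_cinner)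

instantiation complex :: complex_hilbert_space
begin

definition scaleC_complex :: "complex \<Rightarrow> complex \<Rightarrow> complex"
  where "scaleC_complex c x = c * x"

definition cinner_complex :: "complex \<Rightarrow> complex \<Rightarrow> complex"
  where "cinner_complex x y = x * cnj y"

instance
  by standard
    (auto simp: scaleC_complex_def cinner_complex_def algebra_simps scaleR_conv_of_real inner_complex_def)

end

definition closed_csubspace :: "'a::complex_inner set \<Rightarrow> bool"
  where "closed_csubspace M \<longleftrightarrow> csubspace M \<and> closed M"

definition orthogonal_sets :: "'a::complex_inner set \<Rightarrow> 'a set \<Rightarrow> bool"
  where "orthogonal_sets M N \<longleftrightarrow> (\<forall>x\<in>M. \<forall>y\<in>N. cinner x y = 0)"

definition orth_proj :: "'a::complex_inner set \<Rightarrow> 'a \<Rightarrow> 'a"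
  where "orth_proj M x = (THE y. y \<in> M \<and> (\<forall>z\<in>M. cinner (x - y) z = 0))"

(* An operator between subspaces M and N is represented by a function on the ambient space, of
   which only the values on M matter; an operator on the whole space has M = N = UNIV. *)

definition bounded_ops :: "'a::complex_inner set \<Rightarrow> 'a set \<Rightarrow> ('a \<Rightarrow> 'a) set"
  where "bounded_ops M N = {A.
    (\<forall>x\<in>M. A x \<in> N) \<and>
    (\<forall>x\<in>M. \<forall>y\<in>M. A (x + y) = A x + A y) \<and>
    (\<forall>c. \<forall>x\<in>M. A (c *\<^sub>C x) = c *\<^sub>C A x) \<and>
    (\<exists>K. \<forall>x\<in>M. norm (A x) \<le> K * norm x)}"

lemma bounded_ops_UNIV:
  "A \<in> bounded_ops UNIV UNIV \<longleftrightarrow> bounded_linear A \<and> (\<forall>c x. A (c *\<^sub>C x) = c *\<^sub>C A x)"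
  unfolding bounded_ops_def bounded_linear_def bounded_linear_axioms_def linear_iff
  by (auto simp: scaleR_scaleC mult.commute)

definition adj :: "'a::complex_inner set \<Rightarrow> ('a \<Rightarrow> 'a) \<Rightarrow> 'a \<Rightarrow> 'a"
  where "adj M A y = (THE w. w \<in> M \<and> (\<forall>x\<in>M. cinner (A x) y = cinner x w))"

definition isometric_on :: "'a::complex_inner set \<Rightarrow> ('a \<Rightarrow> 'a) \<Rightarrow> bool"
  where "isometric_on M A \<longleftrightarrow> (\<forall>x\<in>M. norm (A x) = norm x)"

definition contraction :: "('a::complex_inner \<Rightarrow> 'a) \<Rightarrow> bool"
  where "contraction T \<longleftrightarrow> T \<in> bounded_ops UNIV UNIV \<and> onorm T \<le> 1"

definition reducing :: "'a::complex_inner set \<Rightarrow> ('a \<Rightarrow> 'a) \<Rightarrow> 'a set \<Rightarrow> bool"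
  where "reducing M A L \<longleftrightarrow>
    closed_csubspace L \<and> L \<subseteq> M \<and> A ` L \<subseteq> L \<and> adj M A ` L \<subseteq> L"

(* An operator is unitary on L iff it is isometric on L and maps L onto L. *)

definition completely_non_unitary :: "'a::complex_inner set \<Rightarrow> ('a \<Rightarrow> 'a) \<Rightarrow> bool"
  where "completely_non_unitary M A \<longleftrightarrow>
    (\<forall>L. reducing M A L \<and> isometric_on L A \<and> A ` L = L \<longrightarrow> L = {0})"

definition positive_op :: "('a::complex_inner \<Rightarrow> 'a) \<Rightarrow> bool"
  where "positive_op B \<longleftrightarrow>
    B \<in> bounded_ops UNIV UNIV \<and> (\<forall>x. cinner (B x) x \<in> \<real>\<^sub>\<ge>\<^sub>0)"

definition sqrt_op :: "('a::complex_inner \<Rightarrow> 'a) \<Rightarrow> 'a \<Rightarrow> 'a"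
  where "sqrt_op A = (THE B. positive_op B \<and> B \<circ> B = A)"

definition defect :: "('a::complex_inner \<Rightarrow> 'a) \<Rightarrow> 'a \<Rightarrow> 'a"
  where "defect T = sqrt_op (\<lambda>x. x - adj UNIV T (T x))"

definition defect_star :: "('a::complex_inner \<Rightarrow> 'a) \<Rightarrow> 'a \<Rightarrow> 'a"
  where "defect_star T = sqrt_op (\<lambda>x. x - T (adj UNIV T x))"

definition defect_space :: "('a::complex_inner \<Rightarrow> 'a) \<Rightarrow> 'a set"
  where "defect_space T = closure (range (defect T))"

definition defect_space_star :: "('a::complex_inner \<Rightarrow> 'a) \<Rightarrow> 'a set"
  where "defect_space_star T = closure (range (defect_star T))"

(* To be evaluated at z in the open unit disc, where I - zT* is bijective, and at h in
   defect_space T. *)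

definition char_fun :: "('a::complex_inner \<Rightarrow> 'a) \<Rightarrow> complex \<Rightarrow> 'a \<Rightarrow> 'a"
  where "char_fun T z h =
    - T h + z *\<^sub>C defect_star T (inv (\<lambda>x. x - z *\<^sub>C adj UNIV T x) (defect T h))"

(* F is, on the open unit disc, a polynomial of degree n with coefficients in L(M,N); constants,
   zero included, have degree 0. *)

definition op_polynomial ::
  "'a::complex_inner set \<Rightarrow> 'a set \<Rightarrow> (complex \<Rightarrow> 'a \<Rightarrow> 'a) \<Rightarrow> nat \<Rightarrow> bool"
  where "op_polynomial M N F n \<longleftrightarrow>
    (\<exists>A. (\<forall>k\<le>n. A k \<in> bounded_ops M N) \<and>
         (\<forall>z\<in>ball 0 1. \<forall>h\<in>M. F z h = (\<Sum>k\<le>n. z ^ k *\<^sub>C A k h)) \<and>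
         (n > 0 \<longrightarrow> (\<exists>h\<in>M. A n h \<noteq> 0)))"

definition pure_isometry :: "'a::complex_inner set \<Rightarrow> ('a \<Rightarrow> 'a) \<Rightarrow> bool"
  where "pure_isometry M V \<longleftrightarrow>
    V \<in> bounded_ops M M \<and> isometric_on M V \<and> completely_non_unitary M V"

definition pure_coisometry :: "'a::complex_inner set \<Rightarrow> ('a \<Rightarrow> 'a) \<Rightarrow> bool"
  where "pure_coisometry M C \<longleftrightarrow> C \<in> bounded_ops M M \<and> pure_isometry M (adj M C)"

(* The multiplicity of the shift is the dimension of the wandering subspace E (possibly 0). *)

definition unilateral_shift :: "'a::complex_inner set \<Rightarrow> ('a \<Rightarrow> 'a) \<Rightarrow> bool"
  where "unilateral_shift M V \<longleftrightarrow>
    V \<in> bounded_ops M M \<and> isometric_on M V \<and>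
    (\<exists>E. closed_csubspace E \<and> E \<subseteq> M \<and>
         (\<forall>i j. i \<noteq> j \<longrightarrow> orthogonal_sets ((V ^^ i) ` E) ((V ^^ j) ` E)) \<and>
         M = closure (cspan (\<Union>i. (V ^^ i) ` E)))"

(* For p = 0 this says M = {0}. *)

definition nilpotent_of_order :: "'a::complex_inner set \<Rightarrow> ('a \<Rightarrow> 'a) \<Rightarrow> nat \<Rightarrow> bool"
  where "nilpotent_of_order M A p \<longleftrightarrow>
    A \<in> bounded_ops M M \<and>
    (\<forall>x\<in>M. (A ^^ p) x = 0) \<and> (\<forall>q<p. \<not> (\<forall>x\<in>M. (A ^^ q) x = 0))"

definition orth_decomp :: "'a::complex_inner set \<Rightarrow> 'a set \<Rightarrow> 'a set \<Rightarrow> bool"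
  where "orth_decomp H1 H0 Hm \<longleftrightarrow>
    closed_csubspace H1 \<and> closed_csubspace H0 \<and> closed_csubspace Hm \<and>
    orthogonal_sets H1 H0 \<and> orthogonal_sets H1 Hm \<and> orthogonal_sets H0 Hm \<and>
    (\<forall>x. \<exists>a\<in>H1. \<exists>b\<in>H0. \<exists>c\<in>Hm. x = a + b + c)"

(* The matrix entry of T from a summand M to a summand N is the restriction of entry T N to M. *)

definition entry :: "('a::complex_inner \<Rightarrow> 'a) \<Rightarrow> 'a set \<Rightarrow> 'a \<Rightarrow> 'a"
  where "entry T N x = orth_proj N (T x)"

(* The operators S, N, C of the matrix are determined by the subspaces, so a representation is
   identified with its triple of subspaces. *)

definition triangular_rep ::
  "('a::complex_inner \<Rightarrow> 'a) \<Rightarrow> nat \<Rightarrow> 'a set \<Rightarrow> 'a set \<Rightarrow> 'a set \<Rightarrow> bool"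
  where "triangular_rep T n H1 H0 Hm \<longleftrightarrow>
    orth_decomp H1 H0 Hm \<and>
    (\<forall>x\<in>H1. entry T H0 x = 0) \<and>
    (\<forall>x\<in>H1. entry T Hm x = 0) \<and>
    (\<forall>x\<in>H0. entry T Hm x = 0) \<and>
    pure_isometry H1 (entry T H1) \<and>
    nilpotent_of_order H0 (entry T H0) n \<and>
    pure_coisometry Hm (entry T Hm)"

definition canonical_rep ::
  "('a::complex_inner \<Rightarrow> 'a) \<Rightarrow> nat \<Rightarrow> 'a set \<Rightarrow> 'a set \<Rightarrow> 'a set \<Rightarrow> bool"
  where "canonical_rep T n H1 H0 Hm \<longleftrightarrow>
    triangular_rep T n H1 H0 Hm \<and>
    (\<forall>K1 K0 Km. triangular_rep T n K1 K0 Km \<longrightarrow> H1 \<subseteq> K1 \<and> Km \<subseteq> Hm)"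

definition canonical_rep_star ::
  "('a::complex_inner \<Rightarrow> 'a) \<Rightarrow> nat \<Rightarrow> 'a set \<Rightarrow> 'a set \<Rightarrow> 'a set \<Rightarrow> bool"
  where "canonical_rep_star T n H1 H0 Hm \<longleftrightarrow>
    triangular_rep T n H1 H0 Hm \<and>
    (\<forall>K1 K0 Km. triangular_rep T n K1 K0 Km \<longrightarrow> K1 \<subseteq> H1 \<and> Hm \<subseteq> Km)"

definition isometric_invariant :: "('a::complex_inner \<Rightarrow> 'a) \<Rightarrow> 'a set \<Rightarrow> bool"
  where "isometric_invariant A L \<longleftrightarrow>
    closed_csubspace L \<and> A ` L \<subseteq> L \<and> isometric_on L A"

definition maximal_isometric_invariant :: "('a::complex_inner \<Rightarrow> 'a) \<Rightarrow> 'a set \<Rightarrow> bool"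
  where "maximal_isometric_invariant A M \<longleftrightarrow>
    isometric_invariant A M \<and> (\<forall>L. isometric_invariant A L \<longrightarrow> L \<subseteq> M)"

end

theory Submission
  imports Defs "HOL-Complex_Analysis.Cauchy_Integral_Formula"
begin

text \<open>
  Write \<open>S\<close> for the adjoint of \<open>T\<close>, \<open>D\<^sup>2 = I - S T\<close> and \<open>D\<^sub>*\<^sup>2 = I - T S\<close>. The Taylor coefficients of the
  characteristic function are \<open>-T\<close> and the operators \<open>D\<^sub>* S\<^sup>k D\<close> restricted to the closure of the range of
  \<open>D\<close> (\<open>char_fun_expansion\<close>). Hence the hypothesis says that \<open>D\<^sub>*\<^sup>2 S\<^sup>k D\<^sup>2 = 0\<close> for all \<open>k \<ge> n\<close> but, if
  \<open>n > 0\<close>, not for \<open>k = n - 1\<close> (\<open>op_polynomial_imp_defect_moments\<close>). This condition contains no square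
  roots, and taking adjoints exchanges the roles of \<open>T\<close> and \<open>S\<close> in it. Getting there requires the
  existence and uniqueness of the positive square root (\<open>positive_sqrt_ex1\<close>), on which the definition of
  the defect operators rests.

  A triple \<open>(H\<^sub>1, H\<^sub>0, H\<^sub>-\<^sub>1)\<close> is a triangular representation iff it is an orthogonal decomposition, \<open>H\<^sub>1\<close> is
  \<open>T\<close>-invariant with \<open>T\<close> isometric on it, \<open>H\<^sub>-\<^sub>1\<close> is \<open>S\<close>-invariant with \<open>S\<close> isometric on it, and the
  compression of \<open>T\<close> to \<open>H\<^sub>0\<close> is nilpotent of order \<open>n\<close> (\<open>triangular_rep_iff\<close>): purity of the two
  isometries is automatic, since a unitary part would reduce \<open>T\<close>. A vector satisfies \<open>\<parallel>T x\<parallel> = \<parallel>x\<parallel>\<close>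
  iff \<open>D\<^sup>2 x = 0\<close>, so the largest \<open>S\<close>-invariant subspace on which \<open>S\<close> is isometric is
  \<open>{x. \<forall>k. D\<^sub>*\<^sup>2 S\<^sup>k x = 0}\<close>. Choose it as \<open>H\<^sub>-\<^sub>1\<close>, put \<open>K = H\<^sub>-\<^sub>1\<^sup>\<bottom>\<close> and let \<open>H\<^sub>1\<close> be the closure of \<open>T\<^sup>n K\<close>.
  The vanishing moments say that \<open>S\<^sup>n D\<^sup>2\<close> maps into \<open>H\<^sub>-\<^sub>1\<close>; dually \<open>D\<^sup>2 T\<^sup>n\<close> vanishes on \<open>K\<close>, so \<open>T\<close> is
  isometric on \<open>H\<^sub>1\<close>. On the rest, \<open>T\<^sup>n\<close> compresses to \<open>0\<close> by construction, and a smaller order would, by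
  the same duality, make the moment for \<open>k = n - 1\<close> vanish (\<open>canonical_rep_exists\<close>). In any other
  representation the coisometric part is contained in this \<open>H\<^sub>-\<^sub>1\<close> by maximality, and \<open>H\<^sub>1\<close> contains the
  image under \<open>T\<^sup>n\<close> of the complement of the coisometric part because the diagonal entry \<open>N\<^sup>n\<close> is \<open>0\<close>; so
  the representation found is the canonical one. Exchanging \<open>T\<close> and \<open>S\<close> gives the other canonical
  representation, and the Wold decomposition (\<open>pure_isometry_imp_unilateral_shift\<close>) identifies the pure
  isometries as shifts.
\<close>

section \<open>Inner products, orthogonal projections and adjoints\<close>

text \<open>The convergence theorems for series ask for the sort \<open>banach\<close>, which is syntactically different
  from its two superclasses together.\<close>

instance complex_hilbert_space \<subseteq> banach ..

lemma cinner_add_right: "cinner x (y + z) = cinner x y + cinner x z"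
  by (metis cinner_add_left cinner_commute complex_cnj_add)

lemma cinner_scaleC_right: "cinner x (c *\<^sub>C y) = cnj c * cinner x y"
  by (metis cinner_commute cinner_scaleC_left complex_cnj_mult)

lemma cinner_zero_left [simp]: "cinner 0 x = 0"
  using cinner_add_left[of 0 0 x] by simp

lemma cinner_zero_right [simp]: "cinner x 0 = 0"
  using cinner_add_right[of x 0 0] by simp

lemma cinner_minus_left: "cinner (- x) y = - cinner x y"
  using cinner_add_left[of x "- x" y] by (simp add: eq_neg_iff_add_eq_0 add.commute)

lemma cinner_minus_right: "cinner x (- y) = - cinner x y"
  using cinner_add_right[of x y "- y"] by (simp add: eq_neg_iff_add_eq_0 add.commute)

lemma cinner_diff_left: "cinner (x - y) z = cinner x z - cinner y z"
  using cinner_add_left[of x "- y" z] by (simp add: cinner_minus_left)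

lemma cinner_diff_right: "cinner x (y - z) = cinner x y - cinner x z"
  using cinner_add_right[of x y "- z"] by (simp add: cinner_minus_right)

lemma cinner_scaleR_left: "cinner (r *\<^sub>R x) y = of_real r * cinner x y"
  by (simp add: scaleR_scaleC cinner_scaleC_left)

lemma cinner_scaleR_right: "cinner x (r *\<^sub>R y) = of_real r * cinner x y"
  by (simp add: scaleR_scaleC cinner_scaleC_right)

lemma cinner_eq_0_sym: "cinner x y = 0 \<longleftrightarrow> cinner y x = 0"
  by (metis cinner_commute complex_cnj_zero)

lemma cinner_self: "cinner x x = of_real ((norm x)\<^sup>2)"
proof -
  have "Im (cinner x x) = 0"
    using arg_cong[OF cinner_commute[of x x], of Im] by simp
  then show ?thesis
    by (simp add: complex_eq_iff flip: inner_eq_Re_cinner power2_norm_eq_inner)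
qed

lemma cinner_self_eq_0 [simp]: "cinner x x = 0 \<longleftrightarrow> x = 0"
  by (simp add: cinner_self)

lemma cinner_eqI: "(\<And>z. cinner x z = cinner y z) \<Longrightarrow> x = y"
  by (metis cinner_diff_left cinner_self_eq_0 right_minus_eq)

lemma cinner_eqI_right: "(\<And>z. cinner z x = cinner z y) \<Longrightarrow> x = y"
  by (metis cinner_commute cinner_eqI)

lemma Im_cinner: "Im (cinner x y) = inner x (\<i> *\<^sub>C y)"
  by (simp add: inner_eq_Re_cinner cinner_scaleC_right)

lemma norm_scaleC: "norm (c *\<^sub>C x) = cmod c * norm x"
proof -
  have "of_real ((norm (c *\<^sub>C x))\<^sup>2) = (c * cnj c) * cinner x x"
    unfolding cinner_self[symmetric] by (simp add: cinner_scaleC_left cinner_scaleC_right)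
  also have "\<dots> = of_real ((cmod c * norm x)\<^sup>2)"
    by (simp add: cinner_self power_mult_distrib flip: complex_norm_square)
  finally have "(norm (c *\<^sub>C x))\<^sup>2 = (cmod c * norm x)\<^sup>2"
    by (simp only: of_real_eq_iff)
  then show ?thesis by simp
qed

lemma norm_cinner_le: "cmod (cinner x y) \<le> norm x * norm y"
proof (cases "cinner x y = 0")
  case False
  define u where "u = cnj (cinner x y) / of_real (cmod (cinner x y))"
  have u: "cmod u = 1" using False by (simp add: u_def norm_divide)
  have "cinner (u *\<^sub>C x) y = of_real (cmod (cinner x y))"
    using False complex_norm_square[of "cinner x y"]
    by (simp add: cinner_scaleC_left u_def field_simps power2_eq_square)
  then have "cmod (cinner x y) = inner (u *\<^sub>C x) y"
    by (simp add: inner_eq_Re_cinner)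
  also have "\<dots> \<le> norm (u *\<^sub>C x) * norm y" by (rule norm_cauchy_schwarz)
  finally show ?thesis by (simp add: norm_scaleC u)
qed simp

lemma bounded_bilinear_cinner: "bounded_bilinear (cinner :: 'a::complex_inner \<Rightarrow> 'a \<Rightarrow> complex)"
  by (rule bounded_bilinear.intro)
    (auto simp: cinner_add_left cinner_add_right cinner_scaleR_left cinner_scaleR_right scaleR_conv_of_real
      intro!: exI[of _ 1] norm_cinner_le)

lemmas tendsto_cinner [tendsto_intros] = bounded_bilinear.tendsto[OF bounded_bilinear_cinner]
lemmas continuous_on_cinner [continuous_intros] = bounded_bilinear.continuous_on[OF bounded_bilinear_cinner]

lemma bounded_linear_scaleC: "bounded_linear (\<lambda>x::'a::complex_inner. c *\<^sub>C x)"
  by (rule bounded_linear_intro[of _ "cmod c"])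
    (auto simp: scaleC_add_right norm_scaleC scaleR_scaleC scaleC_scaleC mult.commute)

lemmas tendsto_scaleC [tendsto_intros] = bounded_linear.tendsto[OF bounded_linear_scaleC]

lemma csubspaceD:
  assumes "csubspace M"
  shows "0 \<in> M" "\<And>x y. x \<in> M \<Longrightarrow> y \<in> M \<Longrightarrow> x + y \<in> M" "\<And>c x. x \<in> M \<Longrightarrow> c *\<^sub>C x \<in> M"
    "\<And>x y. x \<in> M \<Longrightarrow> y \<in> M \<Longrightarrow> x - y \<in> M" "\<And>r x. x \<in> M \<Longrightarrow> r *\<^sub>R x \<in> M"
  using assms
  by (auto simp: scaleR_scaleC complex_vector.subspace_0 complex_vector.subspace_add
      complex_vector.subspace_diff complex_vector.subspace_scale)

lemma csubspaceI:
  "0 \<in> M \<Longrightarrow> (\<And>x y. x \<in> M \<Longrightarrow> y \<in> M \<Longrightarrow> x + y \<in> M) \<Longrightarrow> (\<And>c x. x \<in> M \<Longrightarrow> c *\<^sub>C x \<in> M) \<Longrightarrow> csubspace M"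
  by (simp add: complex_vector.subspace_def)

lemma csubspace_closure:
  assumes "csubspace (M :: 'a::complex_inner set)"
  shows "csubspace (closure M)"
proof (rule csubspaceI)
  show "0 \<in> closure M" using csubspaceD(1)[OF assms] closure_subset by blast
  fix x y assume "x \<in> closure M" "y \<in> closure M"
  then obtain f g where "\<And>n. f n \<in> M" "f \<longlonglongrightarrow> x" "\<And>n. g n \<in> M" "g \<longlonglongrightarrow> y"
    by (auto simp: closure_sequential)
  then show "x + y \<in> closure M"
    unfolding closure_sequential
    by (intro exI[of _ "\<lambda>n. f n + g n"]) (auto intro: csubspaceD(2)[OF assms] tendsto_add)
next
  fix c x assume "x \<in> closure M"
  then obtain f where "\<And>n. f n \<in> M" "f \<longlonglongrightarrow> x"
    by (auto simp: closure_sequential)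
  then show "c *\<^sub>C x \<in> closure M"
    unfolding closure_sequential
    by (intro exI[of _ "\<lambda>n. c *\<^sub>C f n"]) (auto intro: csubspaceD(3)[OF assms] tendsto_scaleC)
qed

definition orth_compl :: "'a::complex_inner set \<Rightarrow> 'a set"
  where "orth_compl M = {x. \<forall>y\<in>M. cinner x y = 0}"

lemma orthogonal_sets_iff: "orthogonal_sets M N \<longleftrightarrow> M \<subseteq> orth_compl N"
  by (auto simp: orthogonal_sets_def orth_compl_def)

lemma orthogonal_sets_sym: "orthogonal_sets M N \<longleftrightarrow> orthogonal_sets N M"
  using cinner_eq_0_sym by (auto simp: orthogonal_sets_def)

lemma orth_compl_antimono: "M \<subseteq> N \<Longrightarrow> orth_compl N \<subseteq> orth_compl M"
  by (auto simp: orth_compl_def)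

lemma closed_csubspace_orth_compl: "closed_csubspace (orth_compl M)"
proof -
  have "orth_compl M = (\<Inter>y\<in>M. {x. cinner x y = 0})" by (auto simp: orth_compl_def)
  moreover have "closed {x. cinner x y = 0}" for y :: 'a
    by (intro closed_Collect_eq continuous_intros)
  ultimately have "closed (orth_compl M)" by auto
  then show ?thesis
    by (auto simp: closed_csubspace_def orth_compl_def cinner_add_left cinner_scaleC_left intro!: csubspaceI)
qed

lemma closed_csubspace_Int:
  "closed_csubspace M \<Longrightarrow> closed_csubspace N \<Longrightarrow> closed_csubspace (M \<inter> N)"
  by (auto simp: closed_csubspace_def complex_vector.subspace_def)

text \<open>A minimizing sequence for the distance to the subspace is Cauchy by the parallelogram law; its
  limit is a nearest point, and the real first-order condition at a nearest point, applied to
  \<open>z\<close> and to \<open>\<i> z\<close>, is complex orthogonality.\<close>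

lemma projection_exists:
  fixes M :: "'a::complex_hilbert_space set"
  assumes "closed_csubspace M"
  shows "\<exists>y\<in>M. \<forall>z\<in>M. cinner (x - y) z = 0"
proof -
  have sub: "csubspace M" and cl: "closed M" using assms by (auto simp: closed_csubspace_def)
  note M = csubspaceD[OF sub]
  define f where "f y = (norm (x - y))\<^sup>2" for y
  define d where "d = Inf (f ` M)"
  have bdd: "bdd_below (f ` M)" by (rule bdd_belowI[of _ 0]) (auto simp: f_def)
  have d_le: "d \<le> f y" if "y \<in> M" for y
    unfolding d_def using that bdd by (intro cInf_lower) auto
  have "\<exists>y\<in>M. f y < d + 1 / (real k + 1)" for k
  proof -
    have "Inf (f ` M) < d + 1 / (real k + 1)" by (simp add: d_def)
    then show ?thesis using cInf_lessD[of "f ` M"] M(1) by blast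
  qed
  then obtain u where u: "\<And>k. u k \<in> M" "\<And>k. f (u k) < d + 1 / (real k + 1)" by metis
  have par: "(norm (u j - u k))\<^sup>2 \<le> 2 / (real j + 1) + 2 / (real k + 1)" for j k
  proof -
    have "(x - u j) + (x - u k) = 2 *\<^sub>R (x - (1/2) *\<^sub>R (u j + u k))"
      by (simp add: scaleR_diff_right scaleR_2)
    then have "(norm ((x - u j) + (x - u k)))\<^sup>2 = 4 * f ((1/2) *\<^sub>R (u j + u k))"
      by (simp add: f_def power_mult_distrib)
    moreover have "(norm (u j - u k))\<^sup>2 = (norm ((x - u j) - (x - u k)))\<^sup>2"
      by (simp add: norm_minus_commute)
    ultimately have "(norm (u j - u k))\<^sup>2 = 2 * f (u j) + 2 * f (u k) - 4 * f ((1/2) *\<^sub>R (u j + u k))"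
      using dot_norm[of "x - u j" "x - u k"] dot_norm_neg[of "x - u j" "x - u k"]
      unfolding f_def by argo
    moreover have "d \<le> f ((1/2) *\<^sub>R (u j + u k))" by (intro d_le M(5) M(2) u(1))
    ultimately show ?thesis using u(2)[of j] u(2)[of k] by linarith
  qed
  have lim0: "(\<lambda>k. 1 / (real k + 1)) \<longlonglongrightarrow> 0"
    using LIMSEQ_inverse_real_of_nat by (simp add: inverse_eq_divide add.commute)
  have "Cauchy u"
  proof (rule metric_CauchyI)
    fix e :: real assume "e > 0"
    then have "eventually (\<lambda>k. 1 / (real k + 1) < e\<^sup>2 / 4) sequentially"
      by (intro order_tendstoD(2)[OF lim0]) simp
    then obtain N where N: "\<And>k. k \<ge> N \<Longrightarrow> 1 / (real k + 1) < e\<^sup>2 / 4"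
      by (auto simp: eventually_sequentially)
    have "dist (u j) (u k) < e" if "j \<ge> N" "k \<ge> N" for j k
    proof -
      have "(norm (u j - u k))\<^sup>2 < e\<^sup>2" using par[of j k] N[OF that(1)] N[OF that(2)] by linarith
      then show ?thesis using \<open>e > 0\<close> by (simp add: dist_norm power_less_imp_less_base)
    qed
    then show "\<exists>N. \<forall>m\<ge>N. \<forall>n\<ge>N. dist (u m) (u n) < e" by blast
  qed
  then obtain y where y: "u \<longlonglongrightarrow> y" using Cauchy_convergent convergent_def by blast
  have yM: "y \<in> M" using closed_sequentially[OF cl] u(1) y by blast
  have "(\<lambda>k. f (u k)) \<longlonglongrightarrow> f y" unfolding f_def by (intro tendsto_intros y)
  moreover have "(\<lambda>k. d + 1 / (real k + 1)) \<longlonglongrightarrow> d + 0"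
    by (intro tendsto_add tendsto_const lim0)
  ultimately have "f y \<le> d + 0"
    by (rule LIMSEQ_le) (intro exI[of _ 0] allI impI less_imp_le u(2))
  then have fy: "f y \<le> d" by simp
  have real_orth: "inner (x - y) z = 0" if z: "z \<in> M" for z
  proof (cases "z = 0")
    case False
    define t where "t = inner (x - y) z / (norm z)\<^sup>2"
    have "f y \<le> f (y + t *\<^sub>R z)" using fy d_le[OF M(2)[OF yM M(5)[OF z]]] by (rule order_trans)
    also have "\<dots> = f y - 2 * t * inner (x - y) z + t\<^sup>2 * (norm z)\<^sup>2"
      using dot_norm_neg[of "x - y" "t *\<^sub>R z"]
      unfolding f_def diff_diff_eq[symmetric] inner_scaleR_right by (simp add: power_mult_distrib field_simps)
    also have "\<dots> = f y - (inner (x - y) z)\<^sup>2 / (norm z)\<^sup>2"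
      using False by (simp add: t_def field_simps power2_eq_square)
    finally show ?thesis using False by (simp add: divide_le_0_iff)
  qed simp
  have "cinner (x - y) z = 0" if "z \<in> M" for z
    using real_orth[OF that] real_orth[OF M(3)[OF that, of "\<i>"]]
    by (simp add: complex_eq_iff inner_eq_Re_cinner Im_cinner)
  with yM show ?thesis by blast
qed

lemma orth_proj_eqI:
  assumes "csubspace M" "y \<in> M" "\<And>z. z \<in> M \<Longrightarrow> cinner (x - y) z = 0"
  shows "orth_proj M x = y"
  unfolding orth_proj_def
proof (rule the_equality)
  fix w assume w: "w \<in> M \<and> (\<forall>z\<in>M. cinner (x - w) z = 0)"
  then have wy: "w - y \<in> M" using assms csubspaceD(4) by blast
  have "cinner (w - y) (w - y) = cinner (x - y) (w - y) - cinner (x - w) (w - y)"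
    by (simp flip: cinner_diff_left)
  also have "\<dots> = 0" using w wy assms(3) by simp
  finally show "w = y" by simp
qed (use assms in auto)

context
  fixes M :: "'a::complex_hilbert_space set"
  assumes M: "closed_csubspace M"
begin

lemma orth_proj:
  shows orth_proj_in: "orth_proj M x \<in> M"
    and orth_proj_orth: "z \<in> M \<Longrightarrow> cinner (x - orth_proj M x) z = 0"
proof -
  obtain y where "y \<in> M" "\<forall>z\<in>M. cinner (x - y) z = 0" using projection_exists[OF M] by blast
  moreover from this have "orth_proj M x = y"
    using M by (intro orth_proj_eqI) (auto simp: closed_csubspace_def)
  ultimately show "orth_proj M x \<in> M" "z \<in> M \<Longrightarrow> cinner (x - orth_proj M x) z = 0" by auto
qed

lemma cinner_orth_proj: "z \<in> M \<Longrightarrow> cinner (orth_proj M x) z = cinner x z"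
  using orth_proj_orth[of z x] by (simp add: cinner_diff_left)

lemma orth_proj_id: "x \<in> M \<Longrightarrow> orth_proj M x = x"
  using M by (intro orth_proj_eqI) (auto simp: closed_csubspace_def)

lemma orth_proj_eq_0: "orth_proj M x = 0 \<longleftrightarrow> x \<in> orth_compl M"
proof
  assume "orth_proj M x = 0"
  then show "x \<in> orth_compl M" using orth_proj_orth[of _ x] by (auto simp: orth_compl_def)
next
  assume "x \<in> orth_compl M"
  then show "orth_proj M x = 0"
    using M by (intro orth_proj_eqI) (auto simp: closed_csubspace_def orth_compl_def csubspaceD(1))
qed

lemma orth_proj_add: "orth_proj M (x + y) = orth_proj M x + orth_proj M y"
proof (rule orth_proj_eqI)
  show "csubspace M" using M by (simp add: closed_csubspace_def)
  then show "orth_proj M x + orth_proj M y \<in> M"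
    by (intro csubspaceD(2) orth_proj_in)
  show "cinner (x + y - (orth_proj M x + orth_proj M y)) z = 0" if "z \<in> M" for z
    using cinner_orth_proj[OF that] by (simp add: cinner_add_left cinner_diff_left)
qed

lemma orth_proj_scaleC: "orth_proj M (c *\<^sub>C x) = c *\<^sub>C orth_proj M x"
proof (rule orth_proj_eqI)
  show "csubspace M" using M by (simp add: closed_csubspace_def)
  then show "c *\<^sub>C orth_proj M x \<in> M"
    by (intro csubspaceD(3) orth_proj_in)
  show "cinner (c *\<^sub>C x - c *\<^sub>C orth_proj M x) z = 0" if "z \<in> M" for z
    using cinner_orth_proj[OF that] by (simp add: cinner_scaleC_left cinner_diff_left)
qed

lemma norm_orth_proj_le: "norm (orth_proj M x) \<le> norm x"
proof -
  have "cinner (orth_proj M x) (orth_proj M x) = cinner x (orth_proj M x)"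
    by (rule cinner_orth_proj[OF orth_proj_in])
  then have "(norm (orth_proj M x))\<^sup>2 = cmod (cinner x (orth_proj M x))"
    by (metis cinner_self norm_of_real abs_power2 power2_abs)
  also have "\<dots> \<le> norm x * norm (orth_proj M x)" by (rule norm_cinner_le)
  finally show ?thesis by (cases "orth_proj M x = 0") (auto simp: power2_eq_square)
qed

lemma orth_compl_orth_compl: "orth_compl (orth_compl M) = M"
proof
  show "M \<subseteq> orth_compl (orth_compl M)"
    by (auto simp: orth_compl_def) (metis cinner_eq_0_sym)
  show "orth_compl (orth_compl M) \<subseteq> M"
  proof
    fix x assume x: "x \<in> orth_compl (orth_compl M)"
    define p where "p = orth_proj M x"
    have "x - p \<in> orth_compl M" using orth_proj_orth by (auto simp: orth_compl_def p_def)
    then have "cinner x (x - p) = 0" "cinner p (x - p) = 0"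
      using x orth_proj_in[of x] by (auto simp: orth_compl_def p_def) (metis cinner_eq_0_sym)
    then have "x = p" by (metis cinner_diff_left cinner_self_eq_0 diff_self right_minus_eq)
    then show "x \<in> M" using orth_proj_in[of x] p_def by simp
  qed
qed

end

lemma bounded_opsI:
  assumes "\<And>x. x \<in> M \<Longrightarrow> A x \<in> N" "\<And>x y. x \<in> M \<Longrightarrow> y \<in> M \<Longrightarrow> A (x + y) = A x + A y"
    "\<And>c x. x \<in> M \<Longrightarrow> A (c *\<^sub>C x) = c *\<^sub>C A x" "\<And>x. x \<in> M \<Longrightarrow> norm (A x) \<le> K * norm x"
  shows "A \<in> bounded_ops M N"
  unfolding bounded_ops_def using assms by blast

lemma bounded_op_UNIV:
  assumes "A \<in> bounded_ops UNIV UNIV"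
  shows bounded_op_add: "A (x + y) = A x + A y"
    and bounded_op_diff: "A (x - y) = A x - A y"
    and bounded_op_scaleC: "A (c *\<^sub>C x) = c *\<^sub>C A x"
    and bounded_op_scaleR: "A (r *\<^sub>R x) = r *\<^sub>R A x"
    and bounded_op_zero: "A 0 = 0"
    and bounded_op_linear: "bounded_linear A"
proof -
  show bl: "bounded_linear A" and "A (c *\<^sub>C x) = c *\<^sub>C A x"
    using assms by (auto simp: bounded_ops_UNIV)
  from bl interpret bounded_linear A .
  show "A (x + y) = A x + A y" "A (x - y) = A x - A y" "A (r *\<^sub>R x) = r *\<^sub>R A x" "A 0 = 0"
    by (auto simp: add diff scaleR)
qed

lemma adj_eqI:
  assumes "csubspace M" "w \<in> M" "\<And>x. x \<in> M \<Longrightarrow> cinner (A x) y = cinner x w"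
  shows "adj M A y = w"
  unfolding adj_def
proof (rule the_equality)
  fix v assume v: "v \<in> M \<and> (\<forall>x\<in>M. cinner (A x) y = cinner x v)"
  then have "v - w \<in> M" using assms csubspaceD(4) by blast
  then have "cinner (v - w) (v - w) = 0" using v assms(3) by (simp add: cinner_diff_right)
  then show "v = w" by simp
qed (use assms in auto)

text \<open>Riesz representation: a functional is the inner product with a multiple of any vector
  orthogonal to its kernel.\<close>

lemma riesz_representation:
  fixes f :: "'a::complex_hilbert_space \<Rightarrow> complex"
  assumes "bounded_linear f" and sc: "\<And>c x. f (c *\<^sub>C x) = c * f x"
  shows "\<exists>w. \<forall>x. f x = cinner x w"
proof (cases "\<forall>x. f x = 0")
  case True
  then show ?thesis by (intro exI[of _ 0]) simp
next
  case False
  interpret bounded_linear f by fact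
  obtain x0 where x0: "f x0 \<noteq> 0" using False by blast
  define K where "K = {x. f x = 0}"
  have "closed K" unfolding K_def
    by (intro closed_Collect_eq continuous_on continuous_on_const continuous_on_id)
  then have K: "closed_csubspace K"
    by (auto simp: closed_csubspace_def K_def add sc zero intro!: csubspaceI)
  define z where "z = x0 - orth_proj K x0"
  have fz: "f z = f x0" using orth_proj_in[OF K, of x0] by (simp add: z_def diff K_def)
  then have z0: "z \<noteq> 0" using x0 zero by auto
  have "f x = cinner x ((cnj (f z) / cinner z z) *\<^sub>C z)" for x
  proof -
    define k where "k = x - (f x / f z) *\<^sub>C z"
    have "k \<in> K" using x0 fz by (simp add: K_def k_def diff sc)
    then have "cinner z k = 0" using orth_proj_orth[OF K] by (simp add: z_def)
    then have "cinner x z = (f x / f z) * cinner z z"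
      using cinner_eq_0_sym[of z k] by (simp add: k_def cinner_diff_left cinner_scaleC_left)
    then show ?thesis
      using z0 x0 fz by (simp add: cinner_scaleC_right cinner_self)
  qed
  then show ?thesis by blast
qed

lemma cinner_adj:
  fixes T :: "'a::complex_hilbert_space \<Rightarrow> 'a"
  assumes "T \<in> bounded_ops UNIV UNIV"
  shows "cinner (T x) y = cinner x (adj UNIV T y)"
proof -
  have "bounded_linear (\<lambda>x. cinner (T x) y)"
    using bounded_linear_compose[OF bounded_bilinear.bounded_linear_left[OF bounded_bilinear_cinner]
        bounded_op_linear[OF assms]] by simp
  then obtain w where "\<forall>x. cinner (T x) y = cinner x w"
    using riesz_representation[of "\<lambda>x. cinner (T x) y"] bounded_op_scaleC[OF assms]
    by (auto simp: cinner_scaleC_left)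
  then show ?thesis by (subst adj_eqI[of UNIV w]) auto
qed

section \<open>Positive square roots and the characteristic function\<close>

lemma positive_op_cinner:
  assumes "positive_op B"
  shows "B \<in> bounded_ops UNIV UNIV" "0 \<le> Re (cinner (B x) x)" "Im (cinner (B x) x) = 0"
  using assms nonnegative_complex_is_real[of "cinner (B x) x"]
  by (auto simp: positive_op_def complex_nonneg_Reals_iff complex_is_Real_iff)

text \<open>By polarization: an operator with a real quadratic form equals its adjoint.\<close>

lemma positive_op_selfadjoint:
  assumes B: "positive_op B"
  shows "cinner (B x) y = cinner x (B y)"
proof -
  note add = bounded_op_add[OF positive_op_cinner(1)[OF B]]
    and sc = bounded_op_scaleC[OF positive_op_cinner(1)[OF B]]
  have re: "cnj (cinner (B z) z) = cinner (B z) z" for z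
    using positive_op_cinner(3)[OF B] by (simp add: complex_eq_iff)
  have e1: "cinner (B x) y + cinner (B y) x = cnj (cinner (B x) y) + cnj (cinner (B y) x)"
    using re[of "x + y"] re[of x] re[of y]
    by (simp add: add cinner_add_left cinner_add_right algebra_simps)
  have e2: "- \<i> * cinner (B x) y + \<i> * cinner (B y) x = \<i> * cnj (cinner (B x) y) - \<i> * cnj (cinner (B y) x)"
    using re[of "x + \<i> *\<^sub>C y"] re[of x] re[of y]
    by (simp add: add sc cinner_add_left cinner_add_right cinner_scaleC_left cinner_scaleC_right algebra_simps)
  have "cinner (B x) y = cnj (cinner (B y) x)"
    using e1 e2 by (auto simp: complex_eq_iff)
  then show ?thesis by (metis cinner_commute)
qed

text \<open>Otherwise the form \<open>\<langle>B u, u\<rangle>\<close> would be negative at \<open>u = x + t B x\<close> for small \<open>t < 0\<close>, where the term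
  \<open>2 t \<parallel>B x\<parallel>\<^sup>2\<close> outweighs the quadratic one.\<close>

lemma positive_op_null:
  assumes B: "positive_op B" and x: "cinner (B x) x = 0"
  shows "B x = 0"
proof (rule ccontr)
  assume "B x \<noteq> 0"
  note op = positive_op_cinner(1)[OF B]
  define b where "b = Re (cinner (B (B x)) (B x))"
  define n where "n = (norm (B x))\<^sup>2"
  have n: "n > 0" using \<open>B x \<noteq> 0\<close> by (simp add: n_def)
  have b: "b \<ge> 0" using positive_op_cinner(2)[OF B] by (simp add: b_def)
  define t where "t = - n / (b + 1)"
  have "0 \<le> Re (cinner (B (x + t *\<^sub>R B x)) (x + t *\<^sub>R B x))"
    by (rule positive_op_cinner(2)[OF B])
  also have "\<dots> = 2 * t * n + t * t * b"
    using positive_op_selfadjoint[OF B, of "B x" x]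
    by (simp add: bounded_op_add[OF op] bounded_op_scaleR[OF op] cinner_add_left cinner_add_right
        cinner_scaleR_left cinner_scaleR_right x b_def n_def cinner_self[of "B x"] algebra_simps)
  also have "\<dots> = t * (2 * n + t * b)" by (simp add: algebra_simps)
  also have "\<dots> < 0"
  proof (rule mult_neg_pos)
    show "t < 0" using n b by (simp add: t_def)
    have "n * b \<le> n * (b + 1)" using n b by simp
    then have "n * b / (b + 1) \<le> n" using b by (simp add: field_simps)
    then show "0 < 2 * n + t * b" using n by (simp add: t_def)
  qed
  finally show False by simp
qed

text \<open>The square root of \<open>I - R\<close> is \<open>I - Y\<close>, where \<open>Y = (R + Y\<^sup>2) / 2\<close>. The fixed-point iteration
  applied to the number \<open>1\<close> in place of \<open>R\<close> increases to a limit at most \<open>1\<close> and dominates, step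
  by step, the iteration applied to \<open>R\<close>.\<close>

primrec sqrt_iter :: "('a::complex_inner \<Rightarrow> 'a) \<Rightarrow> nat \<Rightarrow> 'a \<Rightarrow> 'a" where
  "sqrt_iter R 0 = (\<lambda>x. 0)"
| "sqrt_iter R (Suc k) = (\<lambda>x. (1/2) *\<^sub>R (R x + sqrt_iter R k (sqrt_iter R k x)))"

primrec sqrt_bound :: "nat \<Rightarrow> real" where
  "sqrt_bound 0 = 0"
| "sqrt_bound (Suc k) = (1 + (sqrt_bound k)\<^sup>2) / 2"

lemma sqrt_bound_range: "0 \<le> sqrt_bound k \<and> sqrt_bound k \<le> 1"
  by (induction k) (auto simp: power_le_one)

lemma sqrt_bound_mono: "sqrt_bound k \<le> sqrt_bound (Suc k)"
  using sum_squares_ge_zero[of "sqrt_bound k - 1" 0] by (simp add: power2_eq_square algebra_simps)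

context
  fixes R :: "'a::complex_hilbert_space \<Rightarrow> 'a"
  assumes R: "R \<in> bounded_ops UNIV UNIV" and R_le: "\<And>x. norm (R x) \<le> norm x"
    and R_self: "\<And>x y. cinner (R x) y = cinner x (R y)"
begin

lemma sqrt_iter_linear:
  "sqrt_iter R k (x + y) = sqrt_iter R k x + sqrt_iter R k y"
  "sqrt_iter R k (c *\<^sub>C x) = c *\<^sub>C sqrt_iter R k x"
  by (induction k arbitrary: x y)
    (auto simp: bounded_op_add[OF R] bounded_op_scaleC[OF R] scaleR_scaleC scaleC_add_right scaleC_scaleC mult.commute)

lemma sqrt_iter_diff: "sqrt_iter R k (x - y) = sqrt_iter R k x - sqrt_iter R k y"
  using sqrt_iter_linear(1)[of k "x - y" y] by simp

lemma sqrt_iter_commute: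
  assumes "B \<in> bounded_ops UNIV UNIV" "\<And>x. B (R x) = R (B x)"
  shows "B (sqrt_iter R k x) = sqrt_iter R k (B x)"
  by (induction k arbitrary: x)
    (auto simp: bounded_op_zero[OF assms(1)] bounded_op_add[OF assms(1)] bounded_op_scaleR[OF assms(1)] assms(2))

lemma norm_sqrt_iter_le: "norm (sqrt_iter R k x) \<le> sqrt_bound k * norm x"
proof (induction k arbitrary: x)
  case (Suc k)
  have "norm (sqrt_iter R k (sqrt_iter R k x)) \<le> sqrt_bound k * (sqrt_bound k * norm x)"
    by (rule order_trans[OF Suc mult_left_mono[OF Suc]]) (simp add: sqrt_bound_range)
  then have "norm (R x + sqrt_iter R k (sqrt_iter R k x)) \<le> (1 + (sqrt_bound k)\<^sup>2) * norm x"
    using norm_triangle_ineq[of "R x" "sqrt_iter R k (sqrt_iter R k x)"] R_le[of x]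
    by (simp add: power2_eq_square distrib_right mult.assoc)
  then show ?case by (simp del: scaleR_add_right)
qed simp

lemma sqrt_iter_bounded: "sqrt_iter R k \<in> bounded_ops UNIV UNIV"
  by (rule bounded_opsI[of _ _ _ "sqrt_bound k"]) (auto simp: sqrt_iter_linear norm_sqrt_iter_le)

lemma sqrt_iter_commute_iter: "sqrt_iter R j (sqrt_iter R k x) = sqrt_iter R k (sqrt_iter R j x)"
  by (rule sqrt_iter_commute[OF sqrt_iter_bounded]) (simp add: sqrt_iter_commute[OF R])

lemma norm_sqrt_iter_step_le:
  "norm (sqrt_iter R (Suc k) x - sqrt_iter R k x) \<le> (sqrt_bound (Suc k) - sqrt_bound k) * norm x"
proof (induction k arbitrary: x)
  case 0
  then show ?case using R_le[of x] by simp
next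
  case (Suc k)
  define Y Z where "Y = sqrt_iter R k" and "Z = sqrt_iter R (Suc k)"
  define y z where "y = sqrt_bound k" and "z = sqrt_bound (Suc k)"
  have "sqrt_iter R (Suc (Suc k)) x - sqrt_iter R (Suc k) x = (1/2) *\<^sub>R (Z (Z x) - Y (Y x))"
    by (simp add: Y_def Z_def algebra_simps)
  \<comment> \<open>the iterates commute\<close>
  also have "\<dots> = (1/2) *\<^sub>R (Z (Z x + Y x) - Y (Z x + Y x))"
    unfolding Y_def Z_def sqrt_iter_linear(1) sqrt_iter_commute_iter[of k "Suc k"] by simp
  also have "norm \<dots> \<le> (1/2) * ((z - y) * norm (Z x + Y x))"
    using Suc[of "Z x + Y x"] by (simp add: Y_def Z_def y_def z_def del: sqrt_iter.simps sqrt_bound.simps)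
  also have "\<dots> \<le> (1/2) * ((z - y) * ((z + y) * norm x))"
  proof -
    have "norm (Z x + Y x) \<le> (z + y) * norm x"
      using norm_triangle_ineq[of "Z x" "Y x"] norm_sqrt_iter_le[of k x] norm_sqrt_iter_le[of "Suc k" x]
      unfolding Y_def Z_def y_def z_def distrib_right by linarith
    then show ?thesis
      using sqrt_bound_mono[of k] by (intro mult_left_mono) (auto simp: y_def z_def simp del: sqrt_bound.simps)
  qed
  also have "\<dots> = (sqrt_bound (Suc (Suc k)) - sqrt_bound (Suc k)) * norm x"
  proof -
    have "sqrt_bound (Suc (Suc k)) - sqrt_bound (Suc k) = (z\<^sup>2 - y\<^sup>2) / 2"
      by (simp add: y_def z_def field_simps)
    moreover have "(1/2) * ((z - y) * ((z + y) * norm x)) = (z\<^sup>2 - y\<^sup>2) / 2 * norm x"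
      by (simp add: power2_eq_square algebra_simps)
    ultimately show ?thesis by simp
  qed
  finally show ?case .
qed

lemma sqrt_iter_convergent: "convergent (\<lambda>k. sqrt_iter R k x)"
proof -
  have tel: "(\<Sum>j<k. sqrt_bound (Suc j) - sqrt_bound j) = sqrt_bound k" for k
    using sum_lessThan_telescope[of sqrt_bound k] by simp
  have "summable (\<lambda>k. sqrt_bound (Suc k) - sqrt_bound k)"
    by (rule summableI_nonneg_bounded[where x = 1])
      (simp_all only: tel sqrt_bound_range diff_ge_0_iff_ge sqrt_bound_mono)
  then have "summable (\<lambda>k. (sqrt_bound (Suc k) - sqrt_bound k) * norm x)"
    by (rule summable_mult2)
  then have "summable (\<lambda>k. sqrt_iter R (Suc k) x - sqrt_iter R k x)"
    by (rule summable_comparison_test') (rule norm_sqrt_iter_step_le)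
  then have "convergent (\<lambda>k. \<Sum>j<k. sqrt_iter R (Suc j) x - sqrt_iter R j x)"
    by (simp add: summable_iff_convergent)
  then show ?thesis
    using sum_lessThan_telescope[of "\<lambda>k. sqrt_iter R k x"] by (simp del: sqrt_iter.simps(2))
qed

text \<open>The square root is unique because \<open>Y\<close>, a limit of polynomials in \<open>R\<close>, commutes with everything
  that commutes with \<open>R\<close>. If \<open>B\<^sup>2 = D\<^sup>2\<close> with commuting positive \<open>B\<close>, \<open>D\<close>, then the form of \<open>B + D\<close>
  vanishes on the range of \<open>B - D\<close>, so both \<open>B\<close> and \<open>D\<close> vanish there; hence \<open>(B - D)\<^sup>2 = 0\<close>, and
  \<open>B - D\<close> is self-adjoint.\<close>

lemma positive_sqrt_ex1: "\<exists>!B. positive_op B \<and> B \<circ> B = (\<lambda>x. x - R x)"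
proof -
  define Y where "Y x = lim (\<lambda>k. sqrt_iter R k x)" for x
  have lim: "(\<lambda>k. sqrt_iter R k x) \<longlonglongrightarrow> Y x" for x
    using sqrt_iter_convergent by (simp add: Y_def convergent_LIMSEQ_iff)
  have Y_add: "Y (x + y) = Y x + Y y" for x y
    using tendsto_add[OF lim[of x] lim[of y]] lim[of "x + y"] LIMSEQ_unique by (simp add: sqrt_iter_linear) blast
  have Y_scaleC: "Y (c *\<^sub>C x) = c *\<^sub>C Y x" for c x
    using tendsto_scaleC[OF lim[of x]] lim[of "c *\<^sub>C x"] LIMSEQ_unique by (simp add: sqrt_iter_linear) blast
  have iter_le: "norm (sqrt_iter R k x) \<le> norm x" for k x
    using norm_sqrt_iter_le[of k x] mult_right_mono[of "sqrt_bound k" 1 "norm x"] sqrt_bound_range[of k] by simp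
  have Y_le: "norm (Y x) \<le> norm x" for x
    by (rule LIMSEQ_le_const2[OF tendsto_norm[OF lim]]) (simp add: iter_le)
  have Y: "Y \<in> bounded_ops UNIV UNIV"
    by (rule bounded_opsI[of _ _ _ 1]) (auto simp: Y_add Y_scaleC Y_le)
  have iter_self: "cinner (sqrt_iter R k x) y = cinner x (sqrt_iter R k y)" for k x y
    by (induction k arbitrary: x y)
      (auto simp: cinner_scaleR_left cinner_scaleR_right cinner_add_left cinner_add_right R_self)
  have Y_self: "cinner (Y x) y = cinner x (Y y)" for x y
    using tendsto_cinner[OF lim[of x] tendsto_const[of y]] tendsto_cinner[OF tendsto_const[of x] lim[of y]]
      LIMSEQ_unique by (simp add: iter_self) blast
  have YY: "2 *\<^sub>R Y x = R x + Y (Y x)" for x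
  proof -
    have "(\<lambda>k. sqrt_iter R k (sqrt_iter R k x) - sqrt_iter R k (Y x)) \<longlonglongrightarrow> 0"
    proof (rule Lim_null_comparison)
      show "\<forall>\<^sub>F k in sequentially.
          norm (sqrt_iter R k (sqrt_iter R k x) - sqrt_iter R k (Y x)) \<le> norm (sqrt_iter R k x - Y x)"
        by (simp add: iter_le flip: sqrt_iter_diff)
      show "(\<lambda>k. norm (sqrt_iter R k x - Y x)) \<longlonglongrightarrow> 0"
        using lim LIM_zero tendsto_norm_zero by blast
    qed
    then have "(\<lambda>k. sqrt_iter R k (sqrt_iter R k x)) \<longlonglongrightarrow> Y (Y x)"
      using tendsto_add[OF _ lim[of "Y x"]] by fastforce
    then have "(\<lambda>k. R x + sqrt_iter R k (sqrt_iter R k x)) \<longlonglongrightarrow> R x + Y (Y x)"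
      by (intro tendsto_intros)
    moreover have "(\<lambda>k. 2 *\<^sub>R sqrt_iter R (Suc k) x) \<longlonglongrightarrow> 2 *\<^sub>R Y x"
      by (intro tendsto_intros LIMSEQ_Suc lim)
    ultimately show ?thesis using LIMSEQ_unique by simp blast
  qed
  define D where "D x = x - Y x" for x
  have D: "positive_op D"
    unfolding positive_op_def
  proof (intro conjI allI)
    show "D \<in> bounded_ops UNIV UNIV"
    proof (rule bounded_opsI[of _ _ _ 2])
      show "norm (D x) \<le> 2 * norm x" for x
        using norm_triangle_ineq4[of x "Y x"] Y_le[of x] by (simp add: D_def)
      show "D (c *\<^sub>C x) = c *\<^sub>C D x" for c x
        using complex_vector.scale_right_diff_distrib[of c x "Y x"] by (simp add: D_def Y_scaleC)
    qed (auto simp: D_def Y_add)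
    fix x
    have "Im (cinner (D x) x) = 0"
      using arg_cong[OF Y_self[of x x], of Im] cinner_commute[of x "Y x"] cinner_self[of x]
      by (simp add: D_def cinner_diff_left)
    moreover have "inner (Y x) x \<le> norm x * norm x"
      using norm_cauchy_schwarz[of "Y x" x] mult_right_mono[OF Y_le[of x], of "norm x"] by simp
    then have "0 \<le> Re (cinner (D x) x)"
      by (simp add: D_def cinner_diff_left inner_eq_Re_cinner cinner_self power2_eq_square)
    ultimately show "cinner (D x) x \<in> \<real>\<^sub>\<ge>\<^sub>0" by (simp add: complex_nonneg_Reals_iff)
  qed
  have DD: "D (D x) = x - R x" for x
  proof -
    have "D (D x) = x + Y (Y x) - 2 *\<^sub>R Y x"
      by (simp add: D_def scaleR_2 bounded_op_diff[OF Y])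
    then show ?thesis by (simp add: YY)
  qed
  show ?thesis
  proof (intro ex1I[of _ D] conjI D)
    show "D \<circ> D = (\<lambda>x. x - R x)" by (simp add: fun_eq_iff DD)
    fix B assume "positive_op B \<and> B \<circ> B = (\<lambda>x. x - R x)"
    then have B: "positive_op B" and BB: "B (B x) = x - R x" for x by (auto simp: fun_eq_iff)
    note B_op = positive_op_cinner(1)[OF B] and D_op = positive_op_cinner(1)[OF D]
    have "B (R x) = R (B x)" for x
    proof -
      have "R x = x - B (B x)" for x by (simp add: BB)
      then show ?thesis by (simp add: bounded_op_diff[OF B_op])
    qed
    then have "B (Y x) = Y (B x)" for x
      using bounded_linear.tendsto[OF bounded_op_linear[OF B_op] lim[of x]] lim[of "B x"] LIMSEQ_unique
      by (simp add: sqrt_iter_commute[OF B_op]) blast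
    then have BD: "B (D x) = D (B x)" for x
      by (simp add: D_def bounded_op_diff[OF B_op])
    show "B = D"
    proof
      fix x
      define y where "y = B x - D x"
      have "B y + D y = 0"
        by (simp add: y_def bounded_op_diff[OF B_op] bounded_op_diff[OF D_op] BB DD BD)
      then have "cinner (B y) y + cinner (D y) y = 0" by (simp flip: cinner_add_left)
      then have "Re (cinner (B y) y) = 0" "Re (cinner (D y) y) = 0"
        using positive_op_cinner(2)[OF B, of y] positive_op_cinner(2)[OF D, of y]
        by (auto simp: complex_eq_iff)
      then have "cinner (B y) y = 0" "cinner (D y) y = 0"
        using positive_op_cinner(3)[OF B] positive_op_cinner(3)[OF D] by (auto simp: complex_eq_iff)
      then have "B y = 0" "D y = 0" using positive_op_null B D by blast+
      then have "cinner y y = 0"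
        using positive_op_selfadjoint[OF B, of x y] positive_op_selfadjoint[OF D, of x y]
        by (subst (1) y_def) (simp add: cinner_diff_left)
      then show "B x = D x" by (simp add: y_def)
    qed
  qed
qed

lemma sqrt_op_complement:
  shows "positive_op (sqrt_op (\<lambda>x. x - R x))"
    and "sqrt_op (\<lambda>x. x - R x) (sqrt_op (\<lambda>x. x - R x) x) = x - R x"
  using theI'[OF positive_sqrt_ex1] unfolding sqrt_op_def[symmetric] by (auto simp: fun_eq_iff)

end


text \<open>The sum of the series is a preimage by continuity, and \<open>I - z S\<close> is injective because
  \<open>z S\<close> strictly shrinks nonzero vectors; so \<open>inv\<close> really picks the sum.\<close>

lemma neumann_series:
  fixes S :: "'a::complex_hilbert_space \<Rightarrow> 'a"
  assumes S: "S \<in> bounded_ops UNIV UNIV" and S_le: "\<And>x. norm (S x) \<le> norm x" and z: "cmod z < 1"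
  shows "(\<lambda>k. z ^ k *\<^sub>C (S ^^ k) w) sums inv (\<lambda>x. x - z *\<^sub>C S x) w"
proof -
  define G where "G x = x - z *\<^sub>C S x" for x
  define g where "g k = z ^ k *\<^sub>C (S ^^ k) w" for k
  have pow_le: "norm ((S ^^ k) w) \<le> norm w" for k
    by (induction k) (auto intro: order_trans[OF S_le])
  have "summable (\<lambda>k. cmod z ^ k * norm w)"
    using z by (intro summable_mult2 summable_geometric) simp
  then have "summable g"
    by (rule summable_comparison_test')
      (simp add: g_def norm_scaleC norm_power mult_left_mono pow_le)
  then obtain v where v: "g sums v" by (auto simp: summable_def)
  have "bounded_linear (\<lambda>x. z *\<^sub>C S x)"
    by (rule bounded_linear_compose[OF bounded_linear_scaleC bounded_op_linear[OF S]])
  then have "(\<lambda>k. z *\<^sub>C S (g k)) sums (z *\<^sub>C S v)"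
    using v by (rule bounded_linear.sums)
  then have "(\<lambda>k. g (Suc k)) sums (z *\<^sub>C S v)"
    by (simp add: g_def bounded_op_scaleC[OF S] scaleC_scaleC)
  then have "v = z *\<^sub>C S v + g 0"
    using v sums_Suc sums_unique2 by blast
  then have Gv: "G v = w" by (simp add: G_def g_def algebra_simps)
  have "inj G"
  proof (rule injI)
    fix x y assume "G x = G y"
    then have "x - y = z *\<^sub>C S (x - y)"
      by (simp add: G_def bounded_op_diff[OF S] complex_vector.scale_right_diff_distrib algebra_simps)
    then have "norm (x - y) = cmod z * norm (S (x - y))" by (metis norm_scaleC)
    also have "\<dots> \<le> cmod z * norm (x - y)" by (intro mult_left_mono S_le) simp
    finally have "norm (x - y) = 0"
      using z mult_strict_right_mono[of "cmod z" 1 "norm (x - y)"] by (cases "norm (x - y) = 0") auto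
    then show "x = y" by simp
  qed
  then have "inv G w = v" using Gv by (metis inv_f_f)
  then show ?thesis using v unfolding g_def[abs_def] G_def[abs_def] by simp
qed

lemma power_series_coeffs_unique:
  fixes a b :: "nat \<Rightarrow> complex"
  assumes "\<And>z. cmod z < 1 \<Longrightarrow> (\<lambda>k. a k * z ^ k) sums f z" "\<And>z. cmod z < 1 \<Longrightarrow> (\<lambda>k. b k * z ^ k) sums f z"
  shows "a k = b k"
proof (rule ccontr)
  assume neq: "a k \<noteq> b k"
  define c where "c k = a k - b k" for k
  have c: "(\<lambda>k. c k * z ^ k) sums 0" if "cmod z < 1" for z
    using sums_diff[OF assms[OF that]] by (simp add: c_def left_diff_distrib)
  have "c 0 = 0" using c[of 0] powser_sums_zero_iff[of c 0] by simp
  then have "k > 0" using neq by (cases k) (auto simp: c_def)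
  have False if "0 < s" "\<And>z. z \<in> cball (0::complex) s - {0} \<Longrightarrow> (0::complex) \<noteq> 0" for s
    using that(1) that(2)[of "of_real s"] by simp
  \<comment> \<open>a power series with a nonzero coefficient vanishes at \<open>0\<close> only in isolation\<close>
  moreover have "c k \<noteq> 0" using neq by (simp add: c_def)
  ultimately show False
    using powser_0_nonzero[of 1 0 c "\<lambda>_. 0" k] c \<open>k > 0\<close> by (metis diff_zero zero_less_one)
qed

text \<open>If \<open>S = T\<^sup>*\<close>, then \<open>sq_defect T S\<close> is the square of the defect operator of \<open>T\<close>, and
  \<open>sq_defect S T\<close> the square of that of \<open>T\<^sup>*\<close>.\<close>

definition sq_defect :: "('a::complex_inner \<Rightarrow> 'a) \<Rightarrow> ('a \<Rightarrow> 'a) \<Rightarrow> 'a \<Rightarrow> 'a"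
  where "sq_defect T S x = x - S (T x)"

text \<open>What the hypothesis on the characteristic function amounts to, freed from square roots:
  \<open>D\<^sub>*\<^sup>2 S\<^sup>k D\<^sup>2 = 0\<close> for \<open>k \<ge> n\<close>, and, if \<open>n > 0\<close>, not for \<open>k = n - 1\<close>. Taking adjoints shows that this is
  symmetric in \<open>T\<close> and \<open>S\<close>.\<close>

definition defect_moments_degree :: "('a::complex_inner \<Rightarrow> 'a) \<Rightarrow> ('a \<Rightarrow> 'a) \<Rightarrow> nat \<Rightarrow> bool"
  where "defect_moments_degree T S n \<longleftrightarrow>
    (\<forall>k\<ge>n. \<forall>x. sq_defect S T ((S ^^ k) (sq_defect T S x)) = 0) \<and>
    (n > 0 \<longrightarrow> (\<exists>x. sq_defect S T ((S ^^ (n - 1)) (sq_defect T S x)) \<noteq> 0))"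

text \<open>The adjoint is a parameter, so that every result can be applied with the roles of an operator
  and its adjoint exchanged; the two canonical representations arise from one another in this way.\<close>

locale adjoint_contractions =
  fixes T S :: "'a::complex_hilbert_space \<Rightarrow> 'a"
  assumes T_op: "T \<in> bounded_ops UNIV UNIV" and S_op: "S \<in> bounded_ops UNIV UNIV"
    and T_le: "norm (T x) \<le> norm x" and S_le: "norm (S x) \<le> norm x"
    and cinner_T: "cinner (T x) y = cinner x (S y)"
begin

lemma cinner_S: "cinner (S x) y = cinner x (T y)"
  by (metis cinner_T cinner_commute)

lemma swap: "adjoint_contractions S T"
  by unfold_locales (auto simp: T_op S_op T_le S_le cinner_S)

lemma adj_T: "adj UNIV T = S"
  by (rule ext, rule adj_eqI) (auto simp: cinner_T complex_vector.subspace_UNIV)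

lemma cinner_sq_defect: "cinner (sq_defect T S x) y = cinner x (sq_defect T S y)"
  by (simp add: sq_defect_def cinner_diff_left cinner_diff_right cinner_S cinner_T)

lemma cinner_S_power: "cinner ((S ^^ k) x) y = cinner x ((T ^^ k) y)"
  by (induction k arbitrary: x y) (simp_all add: cinner_S funpow_swap1)

text \<open>\<open>\<parallel>S T x - x\<parallel>\<^sup>2 \<le> \<parallel>x\<parallel>\<^sup>2 - \<parallel>T x\<parallel>\<^sup>2\<close>, by expanding the square.\<close>

lemma norm_T_eq_iff: "norm (T x) = norm x \<longleftrightarrow> sq_defect T S x = 0"
proof
  assume eq: "norm (T x) = norm x"
  have "inner x (S (T x)) = (norm (T x))\<^sup>2"
    by (simp add: inner_eq_Re_cinner cinner_self flip: cinner_T)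
  moreover have "(norm (S (T x)))\<^sup>2 \<le> (norm (T x))\<^sup>2" by (intro power_mono S_le) simp
  ultimately have "(norm (x - S (T x)))\<^sup>2 \<le> 0"
    using dot_norm_neg[of x "S (T x)"] unfolding eq by argo
  then show "sq_defect T S x = 0" by (simp add: sq_defect_def)
next
  assume "sq_defect T S x = 0"
  then have "x = S (T x)" by (simp add: sq_defect_def)
  then have "norm x \<le> norm (T x)" using S_le[of "T x"] by simp
  then show "norm (T x) = norm x" using T_le[of x] by simp
qed

lemma defect_props:
  shows defect_positive: "positive_op (defect T)"
    and defect_defect: "defect T (defect T x) = sq_defect T S x"
proof -
  have "(\<lambda>x. S (T x)) \<in> bounded_ops UNIV UNIV"
    by (rule bounded_opsI[of _ _ _ 1])
      (auto simp: bounded_op_add[OF T_op] bounded_op_add[OF S_op] bounded_op_scaleC[OF T_op]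
        bounded_op_scaleC[OF S_op] intro: order_trans[OF S_le T_le])
  from sqrt_op_complement[OF this]
  show "positive_op (defect T)" "defect T (defect T x) = sq_defect T S x"
    unfolding defect_def adj_T sq_defect_def
    by (auto simp: cinner_S cinner_T intro: order_trans[OF S_le T_le])
qed

lemma defect_eq_0: "defect T x = 0 \<longleftrightarrow> sq_defect T S x = 0"
proof
  assume "sq_defect T S x = 0"
  then have "cinner (defect T x) (defect T x) = 0"
    using positive_op_selfadjoint[OF defect_positive, of x "defect T x"] by (simp add: defect_defect)
  then show "defect T x = 0" by simp
next
  assume "defect T x = 0"
  then show "sq_defect T S x = 0"
    using bounded_op_zero[OF positive_op_cinner(1)[OF defect_positive]] by (simp flip: defect_defect)
qed

lemma defect_star_eq: "defect_star T = defect S"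
  by (simp add: defect_star_def defect_def adj_T adjoint_contractions.adj_T[OF swap])

text \<open>The Neumann series of \<open>(I - z S)\<^sup>-\<^sup>1\<close>, applied to \<open>D h\<close>; the bounded operator \<open>D\<^sub>*\<close> can be moved
  inside the sum.\<close>

lemma char_fun_expansion:
  assumes "cmod z < 1"
  shows "(\<lambda>k. z ^ k *\<^sub>C (case k of 0 \<Rightarrow> - T h | Suc j \<Rightarrow> defect_star T ((S ^^ j) (defect T h))))
    sums char_fun T z h"
proof -
  note D_op = positive_op_cinner(1)[OF adjoint_contractions.defect_positive[OF swap], folded defect_star_eq]
  define v where "v = inv (\<lambda>x. x - z *\<^sub>C S x) (defect T h)"
  have "(\<lambda>k. z ^ k *\<^sub>C (S ^^ k) (defect T h)) sums v"
    unfolding v_def by (rule neumann_series[OF S_op S_le assms])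
  moreover have "bounded_linear (\<lambda>x. z *\<^sub>C defect_star T x)"
    by (rule bounded_linear_compose[OF bounded_linear_scaleC bounded_op_linear[OF D_op]])
  ultimately have "(\<lambda>k. z *\<^sub>C defect_star T (z ^ k *\<^sub>C (S ^^ k) (defect T h))) sums (z *\<^sub>C defect_star T v)"
    by (rule bounded_linear.sums[rotated])
  then have "(\<lambda>k. z ^ Suc k *\<^sub>C (case Suc k of 0 \<Rightarrow> - T h | Suc j \<Rightarrow> defect_star T ((S ^^ j) (defect T h))))
    sums (z *\<^sub>C defect_star T v)"
    by (simp add: bounded_op_scaleC[OF D_op] scaleC_scaleC)
  from sums_Suc[OF this] show ?thesis
    using scaleR_scaleC[of 1 "- T h"] by (simp add: char_fun_def adj_T v_def add.commute)
qed

text \<open>Comparing scalar coefficients of \<open>\<langle>\<Theta>(z) h, y\<rangle>\<close> identifies \<open>D\<^sub>* S\<^sup>k D\<close> on the closure of the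
  range of \<open>D\<close> with the coefficients of the polynomial; composing with \<open>D\<^sub>*\<close> on the left and
  \<open>D\<close> on the right loses no information about vanishing, because both are self-adjoint and so have the
  same kernels as their squares.\<close>

lemma op_polynomial_imp_defect_moments:
  assumes "op_polynomial (defect_space T) (defect_space_star T) (char_fun T) n"
  shows "defect_moments_degree T S n"
proof -
  obtain A where A: "\<And>z h. z \<in> ball 0 1 \<Longrightarrow> h \<in> defect_space T \<Longrightarrow> char_fun T z h = (\<Sum>k\<le>n. z ^ k *\<^sub>C A k h)"
    and lead: "n > 0 \<Longrightarrow> \<exists>h\<in>defect_space T. A n h \<noteq> 0"
    using assms unfolding op_polynomial_def by blast
  have in_space: "defect T x \<in> defect_space T" for x
    unfolding defect_space_def by (rule subsetD[OF closure_subset rangeI])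
  have coeff: "defect_star T ((S ^^ j) (defect T h)) = (if Suc j \<le> n then A (Suc j) h else 0)"
    if h: "h \<in> defect_space T" for j h
  proof (rule cinner_eqI)
    fix y :: 'a
    define a where "a k = (case k of 0 \<Rightarrow> - T h | Suc j \<Rightarrow> defect_star T ((S ^^ j) (defect T h)))" for k
    define b where "b k = (if k \<le> n then A k h else 0)" for k
    have bl: "bounded_linear (\<lambda>x. cinner x y)"
      by (rule bounded_bilinear.bounded_linear_left[OF bounded_bilinear_cinner])
    have "(\<lambda>k. cinner (a k) y * z ^ k) sums cinner (char_fun T z h) y"
      and "(\<lambda>k. cinner (b k) y * z ^ k) sums cinner (char_fun T z h) y" if z: "cmod z < 1" for z
    proof -
      show "(\<lambda>k. cinner (a k) y * z ^ k) sums cinner (char_fun T z h) y"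
        using bounded_linear.sums[OF bl char_fun_expansion[OF z, of h]]
        by (simp add: cinner_scaleC_left mult.commute a_def)
      have "(\<lambda>k. z ^ k *\<^sub>C b k) sums (\<Sum>k\<le>n. z ^ k *\<^sub>C b k)"
        by (rule sums_finite) (auto simp: b_def)
      also have "(\<Sum>k\<le>n. z ^ k *\<^sub>C b k) = char_fun T z h"
        using A[OF _ h] z by (simp add: b_def)
      finally show "(\<lambda>k. cinner (b k) y * z ^ k) sums cinner (char_fun T z h) y"
        using bounded_linear.sums[OF bl] by (fastforce simp: cinner_scaleC_left mult.commute)
    qed
    from power_series_coeffs_unique[OF this, of "Suc j"]
    show "cinner (defect_star T ((S ^^ j) (defect T h))) y = cinner (if Suc j \<le> n then A (Suc j) h else 0) y"
      by (simp add: a_def b_def)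
  qed
  have zero_iff: "defect_star T x = 0 \<longleftrightarrow> sq_defect S T x = 0" for x
    using adjoint_contractions.defect_eq_0[OF swap] by (simp add: defect_star_eq)
  have flip: "cinner (defect_star T ((S ^^ k) (defect T x))) y = cinner x (defect T ((T ^^ k) (defect_star T y)))"
    for k x y
    by (simp add: cinner_S_power positive_op_selfadjoint[OF defect_positive]
        positive_op_selfadjoint[OF adjoint_contractions.defect_positive[OF swap], folded defect_star_eq])
  have vanish: "sq_defect S T ((S ^^ k) (sq_defect T S x)) = 0" if "k \<ge> n" for k x
    using coeff[OF in_space, of k x] that by (simp add: zero_iff defect_defect)
  moreover have "\<exists>x. sq_defect S T ((S ^^ (n - 1)) (sq_defect T S x)) \<noteq> 0" if n: "n > 0"
  proof (rule ccontr)
    assume "\<nexists>x. sq_defect S T ((S ^^ (n - 1)) (sq_defect T S x)) \<noteq> 0"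
    then have "defect_star T ((S ^^ (n - 1)) (defect T (defect T x))) = 0" for x
      by (simp add: zero_iff defect_defect)
    \<comment> \<open>pass to the adjoint to cancel the right factor \<open>D\<close>\<close>
    then have "cinner (defect T x) (defect T ((T ^^ (n - 1)) (defect_star T y))) = 0" for x y
      by (simp only: flip[symmetric] cinner_zero_left)
    then have "defect T ((T ^^ (n - 1)) (defect_star T y)) = 0" for y
      using cinner_self_eq_0 by blast
    then have "defect_star T ((S ^^ (n - 1)) (defect T h)) = 0" for h
      by - (rule cinner_eqI, simp only: flip cinner_zero_left cinner_zero_right)
    then show False using lead[OF n] coeff[of _ "n - 1"] n by auto
  qed
  ultimately show ?thesis by (simp add: defect_moments_degree_def)
qed

lemma defect_moment_swap:
  "(\<forall>x. sq_defect S T ((S ^^ k) (sq_defect T S x)) = 0) \<longleftrightarrow>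
   (\<forall>x. sq_defect T S ((T ^^ k) (sq_defect S T x)) = 0)"
proof -
  have "cinner (sq_defect S T ((S ^^ k) (sq_defect T S x))) y =
      cinner x (sq_defect T S ((T ^^ k) (sq_defect S T y)))" for x y
    by (simp add: adjoint_contractions.cinner_sq_defect[OF swap] cinner_S_power cinner_sq_defect)
  then show ?thesis by (metis cinner_zero_left cinner_zero_right cinner_self_eq_0)
qed

lemma defect_moments_degree_swap: "defect_moments_degree T S n \<Longrightarrow> defect_moments_degree S T n"
  using defect_moment_swap unfolding defect_moments_degree_def by blast

end

lemma contraction_adjoint_contractions:
  assumes "contraction T"
  shows "adjoint_contractions T (adj UNIV T)"
proof
  show T: "T \<in> bounded_ops UNIV UNIV" using assms by (simp add: contraction_def)
  have bl: "bounded_linear T" by (rule bounded_op_linear[OF T])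
  show T_le: "norm (T x) \<le> norm x" for x
    using onorm[OF bl, of x] assms mult_right_mono[of "onorm T" 1 "norm x"] by (simp add: contraction_def)
  show adj: "cinner (T x) y = cinner x (adj UNIV T y)" for x y
    by (rule cinner_adj[OF T])
  let ?S = "adj UNIV T"
  have S_le: "norm (?S y) \<le> norm y" for y
  proof -
    have "(norm (?S y))\<^sup>2 = cmod (cinner (T (?S y)) y)"
      unfolding adj cinner_self by (simp flip: of_real_power)
    also have "\<dots> \<le> norm (T (?S y)) * norm y" by (rule norm_cinner_le)
    also have "\<dots> \<le> norm (?S y) * norm y" by (intro mult_right_mono T_le) simp
    finally show ?thesis by (cases "?S y = 0") (auto simp: power2_eq_square)
  qed
  then show "norm (?S y) \<le> norm y" for y .
  show "?S \<in> bounded_ops UNIV UNIV"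
  proof (rule bounded_opsI[of _ _ _ 1])
    show "?S (x + y) = ?S x + ?S y" for x y
      by (rule cinner_eqI_right) (simp add: cinner_add_right flip: adj)
    show "?S (c *\<^sub>C x) = c *\<^sub>C ?S x" for c x
      by (rule cinner_eqI_right) (simp add: cinner_scaleC_right flip: adj)
  qed (auto simp: S_le)
qed

section \<open>The Wold decomposition\<close>

lemma cinner_isometric:
  assumes M: "csubspace M" and V: "V \<in> bounded_ops M M" "isometric_on M V" and xy: "x \<in> M" "y \<in> M"
  shows "cinner (V x) (V y) = cinner x y"
proof -
  have re: "inner (V u) (V v) = inner u v" if "u \<in> M" "v \<in> M" for u v
  proof -
    have "V u + V v = V (u + v)" using V that by (simp add: bounded_ops_def)
    moreover have "norm (V (u + v)) = norm (u + v)" "norm (V u) = norm u" "norm (V v) = norm v"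
      using V(2) that csubspaceD(2)[OF M that] by (auto simp: isometric_on_def)
    ultimately show ?thesis by (simp add: dot_norm)
  qed
  have "\<i> *\<^sub>C V y = V (\<i> *\<^sub>C y)" using V xy by (simp add: bounded_ops_def)
  then show ?thesis
    using re[OF xy] re[OF xy(1) csubspaceD(3)[OF M xy(2), of \<i>]]
    by (simp add: complex_eq_iff Im_cinner flip: inner_eq_Re_cinner)
qed

lemma funpow_in: "(\<And>x. x \<in> M \<Longrightarrow> V x \<in> M) \<Longrightarrow> x \<in> M \<Longrightarrow> (V ^^ k) x \<in> M"
  by (induction k) auto

lemma closed_csubspace_isometric_image:
  fixes M :: "'a::complex_hilbert_space set"
  assumes M: "closed_csubspace M" and V: "V \<in> bounded_ops M M" "isometric_on M V"
  shows "closed_csubspace (V ` M)"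
proof -
  have sub: "csubspace M" and "closed M" using M by (auto simp: closed_csubspace_def)
  have V_add: "V (x + y) = V x + V y" if "x \<in> M" "y \<in> M" for x y
    using V(1) that by (auto simp: bounded_ops_def)
  have V_scaleC: "V (c *\<^sub>C x) = c *\<^sub>C V x" if "x \<in> M" for c x
    using V(1) that by (auto simp: bounded_ops_def)
  have V_norm: "norm (V x) = norm x" if "x \<in> M" for x
    using V(2) that by (simp add: isometric_on_def)
  have "csubspace (V ` M)"
  proof (rule csubspaceI)
    have "V 0 = 0" using V_norm csubspaceD(1)[OF sub] by fastforce
    then show "0 \<in> V ` M" using csubspaceD(1)[OF sub] by (metis imageI)
    show "x + y \<in> V ` M" if "x \<in> V ` M" "y \<in> V ` M" for x y
      using that V_add csubspaceD(2)[OF sub] by (auto simp: image_iff) metis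
    show "c *\<^sub>C x \<in> V ` M" if "x \<in> V ` M" for c x
      using that V_scaleC csubspaceD(3)[OF sub] by (auto simp: image_iff) metis
  qed
  moreover have "complete (V ` M)"
  proof -
    \<comment> \<open>only the values of \<open>V\<close> on \<open>M\<close> are known to be linear; \<open>W\<close> extends them to the whole space\<close>
    define W where "W x = V (orth_proj M x)" for x
    have WV: "W x = V x" if "x \<in> M" for x using orth_proj_id[OF M that] by (simp add: W_def)
    have "bounded_linear W"
    proof (rule bounded_linear_intro[of _ 1])
      show "W (x + y) = W x + W y" for x y
        by (simp add: W_def orth_proj_add[OF M] V_add orth_proj_in[OF M])
      show "W (r *\<^sub>R x) = r *\<^sub>R W x" for r x
        by (simp add: W_def scaleR_scaleC orth_proj_scaleC[OF M] V_scaleC orth_proj_in[OF M])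
      show "norm (W x) \<le> norm x * 1" for x
        using norm_orth_proj_le[OF M, of x] by (simp add: W_def V_norm orth_proj_in[OF M])
    qed
    moreover have "subspace M" using csubspaceD[OF sub] by (simp add: subspace_def)
    ultimately have "complete (W ` M)"
      using \<open>closed M\<close> by (intro complete_isometric_image[of 1]) (auto simp: WV V_norm complete_eq_closed)
    then show ?thesis by (simp add: WV cong: image_cong)
  qed
  ultimately show ?thesis by (simp add: closed_csubspace_def complete_imp_closed)
qed

text \<open>The wandering subspace is \<open>E = M \<ominus> V M\<close>. What its translates leave over is contained in \<open>V M\<close>,
  and its preimage is left over as well; so it reduces \<open>V\<close> to a unitary operator and vanishes.\<close>

lemma pure_isometry_imp_unilateral_shift:
  fixes M :: "'a::complex_hilbert_space set"
  assumes M: "closed_csubspace M" and pure: "pure_isometry M V"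
  shows "unilateral_shift M V"
proof -
  have V: "V \<in> bounded_ops M M" "isometric_on M V" and cnu: "completely_non_unitary M V"
    using pure by (auto simp: pure_isometry_def)
  have sub: "csubspace M" using M by (simp add: closed_csubspace_def)
  have V_in: "V x \<in> M" if "x \<in> M" for x using V that by (auto simp: bounded_ops_def)
  have pow_in: "(V ^^ k) x \<in> M" if "x \<in> M" for k x
    using funpow_in[of M V] V_in that by blast
  note V_cinner = cinner_isometric[OF sub V]
  have pow_cinner: "cinner ((V ^^ k) x) ((V ^^ k) y) = cinner x y" if "x \<in> M" "y \<in> M" for k x y
    using that by (induction k) (auto simp: V_cinner pow_in)
  note VM = closed_csubspace_isometric_image[OF M V]
  define E where "E = M \<inter> orth_compl (V ` M)"
  define U where "U = (\<Union>i. (V ^^ i) ` E)"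
  define L where "L = M \<inter> orth_compl U"
  define W where "W = closure (cspan U)"
  have E: "closed_csubspace E" "E \<subseteq> M"
    unfolding E_def by (auto intro: closed_csubspace_Int[OF M closed_csubspace_orth_compl])
  have UM: "U \<subseteq> M" using E(2) pow_in by (auto simp: U_def)
  have orth: "cinner ((V ^^ i) e) ((V ^^ j) f) = 0" if "i < j" "e \<in> E" "f \<in> E" for i j e f
  proof -
    obtain d where d: "j = i + Suc d" using \<open>i < j\<close> less_iff_Suc_add by auto
    have "e \<in> M" "f \<in> M" using that E(2) by auto
    have "cinner ((V ^^ i) e) ((V ^^ j) f) = cinner e (V ((V ^^ d) f))"
      using pow_cinner[OF \<open>e \<in> M\<close> V_in[OF pow_in[OF \<open>f \<in> M\<close>, of d]], of i]
      unfolding d funpow_add by simp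
    also have "\<dots> = 0" using \<open>e \<in> E\<close> pow_in[OF \<open>f \<in> M\<close>] by (auto simp: E_def orth_compl_def)
    finally show ?thesis .
  qed
  have "orthogonal_sets ((V ^^ i) ` E) ((V ^^ j) ` E)" if "i \<noteq> j" for i j
  proof (cases "i < j")
    case True
    then show ?thesis using orth by (auto simp: orthogonal_sets_def)
  next
    case False
    then have "orthogonal_sets ((V ^^ j) ` E) ((V ^^ i) ` E)"
      using that orth[of j i] by (auto simp: orthogonal_sets_def)
    then show ?thesis by (simp only: orthogonal_sets_sym)
  qed
  moreover have "M = W"
  proof
    show "W \<subseteq> M"
      unfolding W_def using complex_vector.span_minimal[OF UM sub] M
      by (intro closure_minimal) (auto simp: closed_csubspace_def)
    have W: "closed_csubspace W"
      unfolding W_def closed_csubspace_def by (auto intro: csubspace_closure complex_vector.subspace_span)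
    have UW: "U \<subseteq> W"
      unfolding W_def using complex_vector.span_superset closure_subset by (rule order_trans)
    have L_pre: "\<exists>u\<in>L. x = V u" if x: "x \<in> L" for x
    proof -
      define p where "p = orth_proj (V ` M) x"
      have pVM: "p \<in> V ` M" unfolding p_def by (rule orth_proj_in[OF VM])
      then have "x - p \<in> M" using x V_in csubspaceD(4)[OF sub] by (auto simp: L_def)
      moreover have "x - p \<in> orth_compl (V ` M)"
        using orth_proj_orth[OF VM] by (auto simp: orth_compl_def p_def)
      ultimately have "x - p \<in> E" by (simp add: E_def)
      then have "x - p \<in> U" unfolding U_def by (intro UN_I[of 0]) auto
      then have "cinner x (x - p) = 0" using x by (auto simp: L_def orth_compl_def)
      moreover have "cinner p (x - p) = 0"
        using \<open>x - p \<in> orth_compl (V ` M)\<close> pVM cinner_eq_0_sym by (auto simp: orth_compl_def)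
      ultimately have "x = p" by (metis cinner_diff_left cinner_self_eq_0 diff_self right_minus_eq)
      with pVM obtain u where u: "u \<in> M" "x = V u" by auto
      have "cinner u ((V ^^ i) e) = 0" if "e \<in> E" for i e
      proof -
        have "e \<in> M" using that E(2) by auto
        have "(V ^^ Suc i) e \<in> U" using that unfolding U_def by blast
        then have "cinner x ((V ^^ Suc i) e) = 0" using x by (auto simp: L_def orth_compl_def)
        then show ?thesis using V_cinner[OF u(1) pow_in[OF \<open>e \<in> M\<close>]] u(2) by simp
      qed
      then have "u \<in> L" using u(1) by (auto simp: L_def orth_compl_def U_def)
      then show ?thesis using u(2) by blast
    qed
    have L_closed: "closed_csubspace L"
      unfolding L_def by (intro closed_csubspace_Int M closed_csubspace_orth_compl)
    have VL: "V x \<in> L" if x: "x \<in> L" for x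
    proof -
      have xM: "x \<in> M" using x by (simp add: L_def)
      have "cinner (V x) ((V ^^ i) e) = 0" if e: "e \<in> E" for i e
      proof (cases i)
        case 0
        have "cinner e (V x) = 0" using e xM by (auto simp: E_def orth_compl_def)
        then show ?thesis using 0 cinner_eq_0_sym[of e "V x"] by simp
      next
        case (Suc j)
        have "(V ^^ j) e \<in> U" using e unfolding U_def by blast
        then have "cinner x ((V ^^ j) e) = 0" using x by (auto simp: L_def orth_compl_def)
        then show ?thesis using V_cinner[OF xM pow_in, of e j] e E(2) Suc by auto
      qed
      then show ?thesis using V_in[OF xM] by (auto simp: L_def orth_compl_def U_def)
    qed
    have "adj M V x \<in> L" if x: "x \<in> L" for x
    proof -
      obtain u where u: "u \<in> L" "x = V u" using L_pre[OF x] by blast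
      then have "adj M V x = u" by (intro adj_eqI sub) (auto simp: L_def V_cinner)
      then show ?thesis using u by simp
    qed
    then have "reducing M V L"
      using L_closed VL by (auto simp: reducing_def) (auto simp: L_def)
    moreover have "isometric_on L V" using V(2) by (auto simp: isometric_on_def L_def)
    moreover have "V ` L = L" using VL L_pre by blast
    ultimately have L0: "L = {0}" using cnu by (auto simp: completely_non_unitary_def)
    show "M \<subseteq> W"
    proof
      fix x assume x: "x \<in> M"
      have "x - orth_proj W x \<in> M"
        using x orth_proj_in[OF W] \<open>W \<subseteq> M\<close> csubspaceD(4)[OF sub] by blast
      then have "x - orth_proj W x \<in> L"
        using orth_proj_orth[OF W] UW by (auto simp: L_def orth_compl_def)
      then show "x \<in> W" using L0 orth_proj_in[OF W, of x] by simp
    qed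
  qed
  ultimately show ?thesis
    unfolding unilateral_shift_def W_def U_def using V E by blast
qed

section \<open>Triangular representations\<close>

lemma orth_decomp_swap: "orth_decomp H1 H0 Hm \<Longrightarrow> orth_decomp Hm H0 H1"
  unfolding orth_decomp_def orthogonal_sets_sym[of Hm] orthogonal_sets_sym[of H0 H1]
  by (metis add.commute add.left_commute)

lemma orth_decomp_parts:
  assumes "orth_decomp H1 H0 Hm"
  shows "H1 = orth_compl H0 \<inter> orth_compl Hm" and "H0 = orth_compl H1 \<inter> orth_compl Hm"
proof -
  have parts: "\<exists>a\<in>H1. \<exists>b\<in>H0. \<exists>c\<in>Hm. x = a + b + c" for x
    using assms by (auto simp: orth_decomp_def)
  have orth: "cinner a b = 0" "cinner b a = 0" "cinner a c = 0" "cinner c a = 0" "cinner b c = 0" "cinner c b = 0"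
    if "a \<in> H1" "b \<in> H0" "c \<in> Hm" for a b c
    using assms that cinner_eq_0_sym unfolding orth_decomp_def orthogonal_sets_def by blast+
  have in1: "x \<in> H1" if x: "x \<in> orth_compl H0" "x \<in> orth_compl Hm" for x
  proof -
    obtain a b c where abc: "a \<in> H1" "b \<in> H0" "c \<in> Hm" "x = a + b + c" using parts by blast
    have "cinner x b = 0" "cinner x c = 0" using x abc by (auto simp: orth_compl_def)
    then have "b = 0" "c = 0" using orth[OF abc(1-3)] abc(4) by (auto simp: cinner_add_left)
    then show ?thesis using abc by simp
  qed
  have in0: "x \<in> H0" if x: "x \<in> orth_compl H1" "x \<in> orth_compl Hm" for x
  proof -
    obtain a b c where abc: "a \<in> H1" "b \<in> H0" "c \<in> Hm" "x = a + b + c" using parts by blast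
    have "cinner x a = 0" "cinner x c = 0" using x abc by (auto simp: orth_compl_def)
    then have "a = 0" "c = 0" using orth[OF abc(1-3)] abc(4) by (auto simp: cinner_add_left)
    then show ?thesis using abc by simp
  qed
  have "H1 \<subseteq> orth_compl H0" "H1 \<subseteq> orth_compl Hm" "H0 \<subseteq> orth_compl Hm" "H0 \<subseteq> orth_compl H1"
    using assms orthogonal_sets_sym[of H0 H1] by (auto simp: orth_decomp_def simp flip: orthogonal_sets_iff)
  with in1 in0 show "H1 = orth_compl H0 \<inter> orth_compl Hm" "H0 = orth_compl H1 \<inter> orth_compl Hm"
    by blast+
qed

lemma pure_isometry_cong:
  assumes M: "csubspace M" and AB: "\<And>x. x \<in> M \<Longrightarrow> A x = B x"
  shows "pure_isometry M A \<longleftrightarrow> pure_isometry M B"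
proof -
  have "(\<forall>x\<in>M. cinner (A x) y = cinner x w) \<longleftrightarrow> (\<forall>x\<in>M. cinner (B x) y = cinner x w)" for y w
    using AB by simp
  then have "adj M A = adj M B" by (simp add: adj_def fun_eq_iff)
  moreover have "A ` L = B ` L" if "L \<subseteq> M" for L using that AB by (intro image_cong) auto
  moreover have "isometric_on L A \<longleftrightarrow> isometric_on L B" if "L \<subseteq> M" for L
    using that AB by (auto simp: isometric_on_def subset_eq)
  ultimately have "completely_non_unitary M A \<longleftrightarrow> completely_non_unitary M B"
    unfolding completely_non_unitary_def reducing_def by metis
  moreover have "A \<in> bounded_ops M M \<longleftrightarrow> B \<in> bounded_ops M M"
    unfolding bounded_ops_def using AB csubspaceD(2,3)[OF M] by simp
  moreover have "isometric_on M A \<longleftrightarrow> isometric_on M B"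
    using AB by (simp add: isometric_on_def)
  ultimately show ?thesis by (simp add: pure_isometry_def)
qed

context adjoint_contractions
begin

lemma entry_eq_0: "closed_csubspace N \<Longrightarrow> entry T N x = 0 \<longleftrightarrow> T x \<in> orth_compl N"
  by (simp add: entry_def orth_proj_eq_0)

lemma entry_eq: "closed_csubspace M \<Longrightarrow> T ` M \<subseteq> M \<Longrightarrow> x \<in> M \<Longrightarrow> entry T M x = T x"
  by (simp add: entry_def image_subset_iff orth_proj_id)

lemma entry_bounded: "closed_csubspace M \<Longrightarrow> entry T M \<in> bounded_ops M M"
  by (rule bounded_opsI[of _ _ _ 1])
    (auto simp: entry_def orth_proj_in bounded_op_add[OF T_op] bounded_op_scaleC[OF T_op] orth_proj_add
      orth_proj_scaleC intro: order_trans[OF norm_orth_proj_le T_le])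

lemma cinner_entry:
  assumes "closed_csubspace M" "x \<in> M" "y \<in> M"
  shows "cinner (entry T M x) y = cinner x (entry S M y)"
proof -
  have "cinner (entry T M x) y = cinner x (S y)"
    by (simp add: entry_def cinner_orth_proj[OF assms(1,3)] cinner_T)
  also have "\<dots> = cinner x (entry S M y)"
    using cinner_orth_proj[OF assms(1,2), of "S y"] unfolding entry_def by (metis cinner_commute)
  finally show ?thesis .
qed

lemma adj_entry: "closed_csubspace M \<Longrightarrow> y \<in> M \<Longrightarrow> adj M (entry T M) y = entry S M y"
  using adjoint_contractions.entry_bounded[OF swap, of M]
  by (intro adj_eqI) (auto simp: closed_csubspace_def cinner_entry bounded_ops_def)

lemma entry_eq_0_swap:
  assumes "closed_csubspace M" "closed_csubspace N"
  shows "(\<forall>x\<in>M. entry T N x = 0) \<longleftrightarrow> (\<forall>y\<in>N. entry S M y = 0)"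
  using cinner_eq_0_sym
  by (simp add: entry_eq_0[OF assms(2)] adjoint_contractions.entry_eq_0[OF swap assms(1)] orth_compl_def
      cinner_T) blast

lemma pure_coisometry_entry:
  assumes M: "closed_csubspace M"
  shows "pure_coisometry M (entry T M) \<longleftrightarrow> pure_isometry M (entry S M)"
proof -
  have "pure_isometry M (adj M (entry T M)) \<longleftrightarrow> pure_isometry M (entry S M)"
    using M by (intro pure_isometry_cong adj_entry) (simp_all add: closed_csubspace_def)
  then show ?thesis by (simp add: pure_coisometry_def entry_bounded[OF M])
qed

lemma nilpotent_entry_swap:
  assumes M: "closed_csubspace M" and nil: "nilpotent_of_order M (entry T M) n"
  shows "nilpotent_of_order M (entry S M) n"
proof -
  note T_in = entry_bounded[OF M] and S_in = adjoint_contractions.entry_bounded[OF swap M]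
  have in_M: "(entry T M ^^ q) x \<in> M" "(entry S M ^^ q) x \<in> M" if "x \<in> M" for q x
    using T_in S_in that by (auto intro!: funpow_in simp: bounded_ops_def)
  have ci: "cinner ((entry T M ^^ q) x) y = cinner x ((entry S M ^^ q) y)" if "x \<in> M" "y \<in> M" for q x y
    using that
  proof (induction q arbitrary: y)
    case (Suc q)
    have "cinner ((entry T M ^^ Suc q) x) y = cinner ((entry T M ^^ q) x) (entry S M y)"
      using Suc.prems by (simp add: cinner_entry[OF M] in_M)
    also have "\<dots> = cinner x ((entry S M ^^ Suc q) y)"
      using Suc.IH[OF Suc.prems(1) in_M(2)[OF Suc.prems(2), of 1]] by (simp add: funpow_swap1)
    finally show ?case .
  qed simp
  have "(\<forall>x\<in>M. (entry T M ^^ q) x = 0) \<longleftrightarrow> (\<forall>x\<in>M. (entry S M ^^ q) x = 0)" for q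
    using ci in_M by (metis cinner_self_eq_0 cinner_zero_left cinner_zero_right)
  then show ?thesis using nil S_in by (simp add: nilpotent_of_order_def)
qed

text \<open>The same subspaces reduce \<open>T\<close> and \<open>S\<close>, and on a subspace where one is unitary the other is
  its inverse.\<close>

lemma completely_non_unitary_swap:
  assumes "completely_non_unitary UNIV T"
  shows "completely_non_unitary UNIV S"
  unfolding completely_non_unitary_def
proof (intro allI impI)
  fix L assume L: "reducing UNIV S L \<and> isometric_on L S \<and> S ` L = L"
  have TS: "T (S x) = x" if "x \<in> L" for x
    using L that adjoint_contractions.norm_T_eq_iff[OF swap, of x]
    by (auto simp: isometric_on_def sq_defect_def)
  have "reducing UNIV T L"
    using L by (auto simp: reducing_def adj_T adjoint_contractions.adj_T[OF swap])
  moreover have "T ` L = L"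
  proof -
    have "T ` L = T ` S ` L" using L by simp
    also have "\<dots> = L" using TS by (simp add: image_image)
    finally show ?thesis .
  qed
  moreover have "isometric_on L T"
    unfolding isometric_on_def
  proof
    fix x assume "x \<in> L"
    then have "x \<in> S ` L" using L by simp
    then obtain y where "y \<in> L" "x = S y" by blast
    then show "norm (T x) = norm x" using TS L by (simp add: isometric_on_def)
  qed
  ultimately show "L = {0}" using assms by (auto simp: completely_non_unitary_def)
qed

text \<open>A unitary part of the restriction would reduce \<open>T\<close>, since \<open>S\<close> inverts \<open>T\<close> where \<open>T\<close> is
  isometric.\<close>

lemma isometric_invariant_iff:
  assumes cnu: "completely_non_unitary UNIV T" and M: "closed_csubspace M"
  shows "isometric_invariant T M \<longleftrightarrow> T ` M \<subseteq> M \<and> pure_isometry M (entry T M)"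
proof (cases "T ` M \<subseteq> M")
  case inv: True
  have sub: "csubspace M" using M by (simp add: closed_csubspace_def)
  have "pure_isometry M (entry T M) \<longleftrightarrow> pure_isometry M T"
    by (intro pure_isometry_cong sub entry_eq M inv)
  moreover have "pure_isometry M T" if iso: "isometric_on M T"
    unfolding pure_isometry_def completely_non_unitary_def
  proof (intro conjI allI impI iso)
    show "T \<in> bounded_ops M M"
      using inv by (intro bounded_opsI[of _ _ _ 1]) (auto simp: bounded_op_add[OF T_op] bounded_op_scaleC[OF T_op] T_le)
    fix L assume L: "reducing M T L \<and> isometric_on L T \<and> T ` L = L"
    have "S x \<in> L" if "x \<in> L" for x
    proof -
      have "x \<in> T ` L" using L that by simp
      then obtain u where u: "u \<in> L" "x = T u" by blast
      then have "S x = u" using L norm_T_eq_iff[of u] by (simp add: isometric_on_def sq_defect_def)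
      then show ?thesis using u by simp
    qed
    then have "reducing UNIV T L" using L by (auto simp: reducing_def adj_T)
    then show "L = {0}" using L cnu by (auto simp: completely_non_unitary_def)
  qed
  ultimately show ?thesis
    using M inv by (auto simp: isometric_invariant_def pure_isometry_def)
qed (auto simp: isometric_invariant_def)

text \<open>The three zero entries express that \<open>H\<^sub>1\<close> is \<open>T\<close>-invariant and \<open>H\<^sub>-\<^sub>1\<close> is \<open>S\<close>-invariant. Then the
  first diagonal entry is a restriction of \<open>T\<close>, and the adjoint of the last one a restriction of \<open>S\<close>.\<close>

lemma triangular_rep_iff:
  assumes cnu: "completely_non_unitary UNIV T"
  shows "triangular_rep T n H1 H0 Hm \<longleftrightarrow> orth_decomp H1 H0 Hm \<and> isometric_invariant T H1 \<and>
    isometric_invariant S Hm \<and> nilpotent_of_order H0 (entry T H0) n"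
proof (cases "orth_decomp H1 H0 Hm")
  case decomp: True
  then have closed: "closed_csubspace H1" "closed_csubspace H0" "closed_csubspace Hm"
    by (auto simp: orth_decomp_def)
  note H1 = orth_decomp_parts(1)[OF decomp] and Hm = orth_decomp_parts(1)[OF orth_decomp_swap[OF decomp]]
  have "T ` H1 \<subseteq> H1 \<longleftrightarrow> (\<forall>x\<in>H1. entry T H0 x = 0) \<and> (\<forall>x\<in>H1. entry T Hm x = 0)"
    unfolding entry_eq_0[OF closed(2)] entry_eq_0[OF closed(3)] using H1 by blast
  moreover have "S ` Hm \<subseteq> Hm \<longleftrightarrow> (\<forall>x\<in>H1. entry T Hm x = 0) \<and> (\<forall>x\<in>H0. entry T Hm x = 0)"
    unfolding entry_eq_0_swap[OF closed(1,3)] entry_eq_0_swap[OF closed(2,3)]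
      adjoint_contractions.entry_eq_0[OF swap closed(1)] adjoint_contractions.entry_eq_0[OF swap closed(2)]
    using Hm by blast
  ultimately show ?thesis
    using decomp isometric_invariant_iff[OF cnu closed(1)] pure_coisometry_entry[OF closed(3)]
      adjoint_contractions.isometric_invariant_iff[OF swap completely_non_unitary_swap[OF cnu] closed(3)]
    unfolding triangular_rep_def by blast
qed (simp add: triangular_rep_def)

lemma triangular_rep_swap:
  assumes "completely_non_unitary UNIV T" "triangular_rep T n H1 H0 Hm"
  shows "triangular_rep S n Hm H0 H1"
  using assms nilpotent_entry_swap[of H0 n] orth_decomp_swap[of H1 H0 Hm]
  unfolding triangular_rep_iff[OF assms(1)]
    adjoint_contractions.triangular_rep_iff[OF swap completely_non_unitary_swap[OF assms(1)]]
  by (simp add: orth_decomp_def)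

text \<open>\<open>T\<close> maps both \<open>H\<^sub>1\<close> and \<open>H\<^sub>1 \<oplus> H\<^sub>0\<close>, the complement of the \<open>S\<close>-invariant \<open>H\<^sub>-\<^sub>1\<close>, to themselves, so
  compressing to \<open>H\<^sub>0\<close> commutes with taking powers on \<open>H\<^sub>1 \<oplus> H\<^sub>0\<close>.\<close>

lemma compression_power:
  assumes decomp: "orth_decomp H1 H0 Hm" and T1: "T ` H1 \<subseteq> H1" and Sm: "S ` Hm \<subseteq> Hm"
    and x: "x \<in> orth_compl Hm"
  shows "(T ^^ k) x \<in> orth_compl Hm" and "(entry T H0 ^^ k) (orth_proj H0 x) = orth_proj H0 ((T ^^ k) x)"
proof -
  have closed: "closed_csubspace H1" "closed_csubspace H0" "closed_csubspace Hm"
    using decomp by (auto simp: orth_decomp_def)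
  note H1 = orth_decomp_parts(1)[OF decomp]
  have T_in: "T y \<in> orth_compl Hm" if "y \<in> orth_compl Hm" for y
    using that Sm by (auto simp: orth_compl_def cinner_T)
  then show in_compl: "(T ^^ k) x \<in> orth_compl Hm" for k using x by (rule funpow_in)
  have step: "entry T H0 (orth_proj H0 y) = orth_proj H0 (T y)" if y: "y \<in> orth_compl Hm" for y
  proof -
    define b where "b = orth_proj H0 y"
    have b: "b \<in> H0" by (simp add: b_def orth_proj_in[OF closed(2)])
    then have "b \<in> orth_compl Hm" using orth_decomp_parts(2)[OF decomp] by blast
    then have "y - b \<in> orth_compl Hm" using y by (simp add: orth_compl_def cinner_diff_left)
    moreover have "y - b \<in> orth_compl H0"
      using orth_proj_orth[OF closed(2)] by (simp add: orth_compl_def b_def)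
    ultimately have "T (y - b) \<in> H1" using H1 T1 by blast
    then have "T (y - b) \<in> orth_compl H0" using H1 by blast
    then have "orth_proj H0 (T (y - b)) = 0" using orth_proj_eq_0[OF closed(2)] by blast
    moreover have "T y = T (y - b) + T b" by (simp add: bounded_op_diff[OF T_op])
    ultimately show ?thesis by (simp add: orth_proj_add[OF closed(2)] entry_def flip: b_def)
  qed
  show "(entry T H0 ^^ k) (orth_proj H0 x) = orth_proj H0 ((T ^^ k) x)"
    by (induction k) (auto simp: step in_compl)
qed

text \<open>On \<open>H\<^sub>1 \<oplus> H\<^sub>0\<close> the values of \<open>T\<^sup>n\<close> have no component in \<open>H\<^sub>0\<close>, because the diagonal entry there is
  \<open>N\<^sup>n = 0\<close>. This bounds every \<open>H\<^sub>1\<close> from below.\<close>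

lemma triangular_rep_power_range:
  assumes cnu: "completely_non_unitary UNIV T" and rep: "triangular_rep T n H1 H0 Hm" and x: "x \<in> orth_compl Hm"
  shows "(T ^^ n) x \<in> H1"
proof -
  have decomp: "orth_decomp H1 H0 Hm" and inv: "T ` H1 \<subseteq> H1" "S ` Hm \<subseteq> Hm"
    and nil: "\<And>y. y \<in> H0 \<Longrightarrow> (entry T H0 ^^ n) y = 0"
    using rep unfolding triangular_rep_iff[OF cnu]
    by (auto simp: isometric_invariant_def nilpotent_of_order_def)
  have H0: "closed_csubspace H0" using decomp by (simp add: orth_decomp_def)
  note power = compression_power[OF decomp inv x, of n]
  have "orth_proj H0 ((T ^^ n) x) = 0"
    using power(2) nil[OF orth_proj_in[OF H0]] by simp
  then have "(T ^^ n) x \<in> orth_compl H0" using orth_proj_eq_0[OF H0] by blast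
  then show ?thesis using power(1) orth_decomp_parts(1)[OF decomp] by blast
qed

end

section \<open>The canonical representations\<close>

text \<open>The largest invariant subspace on which \<open>T\<close> is isometric: the vectors \<open>x\<close> with
  \<open>D T\<^sup>k x = 0\<close> for all \<open>k\<close>. Written as an orthogonal complement, it is visibly a closed subspace.\<close>

definition isometric_part :: "('a::complex_inner \<Rightarrow> 'a) \<Rightarrow> ('a \<Rightarrow> 'a) \<Rightarrow> 'a set"
  where "isometric_part T S = orth_compl (\<Union>k. range (\<lambda>y. (S ^^ k) (sq_defect T S y)))"

context adjoint_contractions
begin

lemma cinner_power_sq_defect:
  "cinner x ((S ^^ k) (sq_defect T S y)) = cinner (sq_defect T S ((T ^^ k) x)) y"
  by (simp add: cinner_sq_defect adjoint_contractions.cinner_S_power[OF swap])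

lemma isometric_part_iff: "x \<in> isometric_part T S \<longleftrightarrow> (\<forall>k. sq_defect T S ((T ^^ k) x) = 0)"
proof -
  have "x \<in> isometric_part T S \<longleftrightarrow> (\<forall>k y. cinner (sq_defect T S ((T ^^ k) x)) y = 0)"
    by (auto simp: isometric_part_def orth_compl_def cinner_power_sq_defect)
  also have "\<dots> \<longleftrightarrow> (\<forall>k. sq_defect T S ((T ^^ k) x) = 0)"
    by (metis cinner_self_eq_0 cinner_zero_left)
  finally show ?thesis .
qed

lemma maximal_isometric_part: "maximal_isometric_invariant T (isometric_part T S)"
  unfolding maximal_isometric_invariant_def isometric_invariant_def
proof (intro conjI allI impI)
  show "closed_csubspace (isometric_part T S)"
    unfolding isometric_part_def by (rule closed_csubspace_orth_compl)
  show "T ` isometric_part T S \<subseteq> isometric_part T S"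
  proof clarify
    fix x assume "x \<in> isometric_part T S"
    then have "sq_defect T S ((T ^^ Suc k) x) = 0" for k by (simp only: isometric_part_iff)
    then show "T x \<in> isometric_part T S" by (simp add: isometric_part_iff funpow_swap1)
  qed
  show "isometric_on (isometric_part T S) T"
    unfolding isometric_on_def
  proof
    fix x assume "x \<in> isometric_part T S"
    then have "sq_defect T S ((T ^^ 0) x) = 0" by (simp only: isometric_part_iff)
    then show "norm (T x) = norm x" by (simp add: norm_T_eq_iff)
  qed
  fix L assume L: "closed_csubspace L \<and> T ` L \<subseteq> L \<and> isometric_on L T"
  show "L \<subseteq> isometric_part T S"
  proof
    fix x assume "x \<in> L"
    then have "(T ^^ k) x \<in> L" for k using L by (intro funpow_in) auto
    then show "x \<in> isometric_part T S"
      using L by (simp add: isometric_part_iff isometric_on_def flip: norm_T_eq_iff)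
  qed
qed

text \<open>Take \<open>H\<^sub>-\<^sub>1\<close> as large as possible and then, with \<open>K = H\<^sub>-\<^sub>1\<^sup>\<bottom>\<close>, take \<open>H\<^sub>1\<close> as small as nilpotency of
  order at most \<open>n\<close> on the rest allows, namely the closure of \<open>T\<^sup>n K\<close>. The vanishing of the moments says that
  \<open>S\<^sup>n D\<^sup>2\<close> maps into \<open>H\<^sub>-\<^sub>1\<close>, and this is adjoint to \<open>D\<^sup>2 T\<^sup>n\<close> vanishing on \<open>K\<close>, that is, to \<open>T\<close>
  being isometric on \<open>H\<^sub>1\<close>. If the order were smaller, \<open>T\<^sup>n\<^sup>-\<^sup>1 K\<close> would already lie in \<open>H\<^sub>1\<close>, and the
  same duality would annihilate the last moment.\<close>

lemma canonical_rep_exists: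
  assumes cnu: "completely_non_unitary UNIV T" and moments: "defect_moments_degree T S n"
  shows "\<exists>H1 H0 Hm. canonical_rep T n H1 H0 Hm \<and> maximal_isometric_invariant S Hm"
proof -
  define Hm where "Hm = isometric_part S T"
  define K where "K = orth_compl Hm"
  define H1 where "H1 = closure ((T ^^ n) ` K)"
  define H0 where "H0 = K \<inter> orth_compl H1"
  have max: "maximal_isometric_invariant S Hm"
    unfolding Hm_def by (rule adjoint_contractions.maximal_isometric_part[OF swap])
  then have Hm_iso: "isometric_invariant S Hm" by (simp add: maximal_isometric_invariant_def)
  then have Hm: "closed_csubspace Hm" and SHm: "S ` Hm \<subseteq> Hm" by (auto simp: isometric_invariant_def)
  have K: "closed_csubspace K" unfolding K_def by (rule closed_csubspace_orth_compl)
  have subK: "csubspace K" "closed K" using K by (auto simp: closed_csubspace_def)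
  have TK: "T x \<in> K" if "x \<in> K" for x
    using that SHm by (auto simp: K_def orth_compl_def cinner_T)
  have powK: "(T ^^ k) x \<in> K" if "x \<in> K" for k x
    using funpow_in[of K T] TK that by blast
  have pow_lin: "(T ^^ k) (x + y) = (T ^^ k) x + (T ^^ k) y" "(T ^^ k) (c *\<^sub>C x) = c *\<^sub>C (T ^^ k) x"
    "(T ^^ k) 0 = 0" for k x y c
    by (induction k) (auto simp: bounded_op_add[OF T_op] bounded_op_scaleC[OF T_op] bounded_op_zero[OF T_op])
  have pow_pow: "(F ^^ j) ((F ^^ k) x) = (F ^^ (j + k)) x" for F :: "'a \<Rightarrow> 'a" and j k x
    by (simp add: funpow_add)
  have "csubspace ((T ^^ n) ` K)"
  proof (rule csubspaceI)
    show "0 \<in> (T ^^ n) ` K" using pow_lin(3) csubspaceD(1)[OF subK(1)] by (metis imageI)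
    show "x + y \<in> (T ^^ n) ` K" if "x \<in> (T ^^ n) ` K" "y \<in> (T ^^ n) ` K" for x y
      using that csubspaceD(2)[OF subK(1)] by (auto simp flip: pow_lin(1))
    show "c *\<^sub>C x \<in> (T ^^ n) ` K" if "x \<in> (T ^^ n) ` K" for c x
      using that csubspaceD(3)[OF subK(1)] by (auto simp flip: pow_lin(2))
  qed
  then have H1: "closed_csubspace H1" by (simp add: closed_csubspace_def H1_def csubspace_closure)
  have H1K: "H1 \<subseteq> K" unfolding H1_def using powK subK(2) by (intro closure_minimal) auto
  have H0: "closed_csubspace H0"
    unfolding H0_def by (intro closed_csubspace_Int K closed_csubspace_orth_compl)
  have decomp: "orth_decomp H1 H0 Hm"
    unfolding orth_decomp_def
  proof (intro conjI allI H1 H0 Hm)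
    show "orthogonal_sets H1 Hm" "orthogonal_sets H0 Hm"
      using H1K by (auto simp: orthogonal_sets_iff K_def H0_def)
    show "orthogonal_sets H1 H0"
      by (subst orthogonal_sets_sym) (auto simp: orthogonal_sets_iff H0_def)
    fix x
    define k where "k = x - orth_proj Hm x"
    define b where "b = k - orth_proj H1 k"
    have "k \<in> K" using orth_proj_orth[OF Hm] by (simp add: k_def K_def orth_compl_def)
    then have "b \<in> K"
      using H1K orth_proj_in[OF H1] csubspaceD(4)[OF subK(1)] unfolding b_def by blast
    then have "b \<in> H0" using orth_proj_orth[OF H1] by (simp add: H0_def orth_compl_def b_def)
    moreover have "x = orth_proj H1 k + b + orth_proj Hm x" by (simp add: b_def k_def)
    ultimately show "\<exists>a\<in>H1. \<exists>b\<in>H0. \<exists>c\<in>Hm. x = a + b + c"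
      using orth_proj_in[OF H1] orth_proj_in[OF Hm] by blast
  qed
  have TH1: "T ` H1 \<subseteq> H1"
  proof -
    have "T ` H1 \<subseteq> closure (T ` (T ^^ n) ` K)"
      unfolding H1_def by (rule closure_bounded_linear_image_subset[OF bounded_op_linear[OF T_op]])
    also have "T ` (T ^^ n) ` K \<subseteq> (T ^^ n) ` K"
      using TK by (auto simp: funpow_swap1[symmetric] image_iff) (metis funpow_swap1)
    then have "closure (T ` (T ^^ n) ` K) \<subseteq> H1" unfolding H1_def by (rule closure_mono)
    finally show ?thesis .
  qed
  have isoH1: "sq_defect T S x = 0" if "x \<in> H1" for x
  proof -
    have "(T ^^ n) ` K \<subseteq> orth_compl (range (sq_defect T S))"
    proof clarify
      fix y assume y: "y \<in> K"
      have "(S ^^ n) (sq_defect T S z) \<in> Hm" for z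
        using moments by (simp add: Hm_def adjoint_contractions.isometric_part_iff[OF swap]
            defect_moments_degree_def pow_pow)
      then have "cinner y ((S ^^ n) (sq_defect T S z)) = 0" for z
        using y by (simp add: K_def orth_compl_def)
      then show "(T ^^ n) y \<in> orth_compl (range (sq_defect T S))"
        by (simp add: orth_compl_def cinner_power_sq_defect flip: cinner_sq_defect)
    qed
    then have "H1 \<subseteq> orth_compl (range (sq_defect T S))"
      unfolding H1_def using closed_csubspace_orth_compl by (intro closure_minimal) (auto simp: closed_csubspace_def)
    then have "cinner x (sq_defect T S (sq_defect T S x)) = 0" using that by (auto simp: orth_compl_def)
    then show ?thesis using cinner_sq_defect[of x "sq_defect T S x"] by simp
  qed
  then have H1_iso: "isometric_invariant T H1"
    using H1 TH1 by (auto simp: isometric_invariant_def isometric_on_def norm_T_eq_iff)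
  have nil: "nilpotent_of_order H0 (entry T H0) n"
    unfolding nilpotent_of_order_def
  proof (intro conjI allI impI ballI entry_bounded H0)
    note power = compression_power(2)[OF decomp TH1 SHm, folded K_def]
    show "(entry T H0 ^^ n) x = 0" if x: "x \<in> H0" for x
    proof -
      have "x \<in> K" using x by (simp add: H0_def)
      then have "(T ^^ n) x \<in> H1" unfolding H1_def by (intro subsetD[OF closure_subset] imageI)
      then have "(T ^^ n) x \<in> orth_compl H0" using orth_decomp_parts(1)[OF decomp] by blast
      then show ?thesis
        using power[OF \<open>x \<in> K\<close>, of n] orth_proj_id[OF H0 x] orth_proj_eq_0[OF H0] by simp
    qed
    fix q assume q: "q < n"
    show "\<not> (\<forall>x\<in>H0. (entry T H0 ^^ q) x = 0)"
    proof
      assume zero: "\<forall>x\<in>H0. (entry T H0 ^^ q) x = 0"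
      have "sq_defect T S ((T ^^ (n - 1)) y) = 0" if y: "y \<in> K" for y
      proof -
        have "orth_proj H0 ((T ^^ q) y) = 0"
          using power[OF y, of q] zero orth_proj_in[OF H0, of y] by simp
        then have "(T ^^ q) y \<in> orth_compl H0 \<inter> orth_compl Hm"
          using orth_proj_eq_0[OF H0] powK[OF y] by (simp add: K_def)
        then have "(T ^^ q) y \<in> H1" using orth_decomp_parts(1)[OF decomp] by simp
        then have "(T ^^ (n - 1 - q)) ((T ^^ q) y) \<in> H1" using funpow_in[of H1 T] TH1 by blast
        moreover have "(T ^^ (n - 1 - q)) ((T ^^ q) y) = (T ^^ (n - 1)) y"
          using q by (simp add: pow_pow)
        ultimately show ?thesis using isoH1 by simp
      qed
      then have "cinner y ((S ^^ (n - 1)) (sq_defect T S z)) = 0" if "y \<in> K" for y z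
        using that by (simp add: cinner_power_sq_defect)
      then have "(S ^^ (n - 1)) (sq_defect T S z) \<in> orth_compl K" for z
        using cinner_eq_0_sym by (simp add: orth_compl_def) blast
      then have "(S ^^ (n - 1)) (sq_defect T S z) \<in> Hm" for z
        by (simp add: K_def orth_compl_orth_compl[OF Hm])
      then have "sq_defect S T ((S ^^ 0) ((S ^^ (n - 1)) (sq_defect T S z))) = 0" for z
        unfolding Hm_def adjoint_contractions.isometric_part_iff[OF swap] by blast
      then show False using moments q by (simp add: defect_moments_degree_def)
    qed
  qed
  have "H1 \<subseteq> K1 \<and> Km \<subseteq> Hm" if rep: "triangular_rep T n K1 K0 Km" for K1 K0 Km
  proof
    have "isometric_invariant S Km" using rep by (simp add: triangular_rep_iff[OF cnu])
    then show KmHm: "Km \<subseteq> Hm" using max by (simp add: maximal_isometric_invariant_def)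
    have "(T ^^ n) ` K \<subseteq> K1"
      using triangular_rep_power_range[OF cnu rep] orth_compl_antimono[OF KmHm] by (auto simp: K_def)
    moreover have "closed K1" using rep by (simp add: triangular_rep_def orth_decomp_def closed_csubspace_def)
    ultimately show "H1 \<subseteq> K1" unfolding H1_def by (rule closure_minimal)
  qed
  then have "canonical_rep T n H1 H0 Hm"
    using decomp H1_iso Hm_iso nil unfolding canonical_rep_def triangular_rep_iff[OF cnu] by blast
  then show ?thesis using max by blast
qed

lemma triangular_rep_swap_iff:
  assumes "completely_non_unitary UNIV T"
  shows "triangular_rep T n H1 H0 Hm \<longleftrightarrow> triangular_rep S n Hm H0 H1"
  using triangular_rep_swap[OF assms]
    adjoint_contractions.triangular_rep_swap[OF swap completely_non_unitary_swap[OF assms]] by blast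

lemma canonical_rep_star_iff:
  assumes "completely_non_unitary UNIV T"
  shows "canonical_rep_star T n H1 H0 Hm \<longleftrightarrow> canonical_rep S n Hm H0 H1"
  unfolding canonical_rep_star_def canonical_rep_def triangular_rep_swap_iff[OF assms] by blast

lemma triangular_rep_shifts:
  assumes "triangular_rep T n H1 H0 Hm"
  shows "unilateral_shift H1 (entry T H1)" "unilateral_shift Hm (adj Hm (entry T Hm))"
  using assms
  by (auto simp: triangular_rep_def orth_decomp_def pure_coisometry_def intro: pure_isometry_imp_unilateral_shift)

end

lemma canonical_rep_unique:
  assumes "canonical_rep T n H1 H0 Hm" "canonical_rep T n K1 K0 Km"
  shows "K1 = H1 \<and> K0 = H0 \<and> Km = Hm"
proof -
  have reps: "triangular_rep T n H1 H0 Hm" "triangular_rep T n K1 K0 Km"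
    using assms by (auto simp: canonical_rep_def)
  then have "K1 = H1" "Km = Hm" using assms unfolding canonical_rep_def by blast+
  moreover have "orth_decomp H1 H0 Hm" "orth_decomp K1 K0 Km"
    using reps by (auto simp: triangular_rep_def)
  ultimately show ?thesis using orth_decomp_parts(2) by metis
qed

theorem theorem3p3:
  fixes T :: "'a::complex_hilbert_space \<Rightarrow> 'a" and n :: nat
  assumes separable: "separable_space (euclidean :: 'a topology)"
    and contraction: "contraction T"
    and cnu: "completely_non_unitary UNIV T"
    and poly: "op_polynomial (defect_space T) (defect_space_star T) (char_fun T) n"
  shows "(\<exists>H1 H0 Hm. triangular_rep T n H1 H0 Hm)
    \<and> (\<forall>H1 H0 Hm. triangular_rep T n H1 H0 Hm \<longrightarrow>
          unilateral_shift H1 (entry T H1) \<and> unilateral_shift Hm (adj Hm (entry T Hm)))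
    \<and> (\<exists>H1 H0 Hm. canonical_rep T n H1 H0 Hm
          \<and> (\<forall>K1 K0 Km. canonical_rep T n K1 K0 Km \<longrightarrow> K1 = H1 \<and> K0 = H0 \<and> Km = Hm)
          \<and> maximal_isometric_invariant (adj UNIV T) Hm)
    \<and> (\<exists>H1 H0 Hm. canonical_rep_star T n H1 H0 Hm
          \<and> (\<forall>K1 K0 Km. canonical_rep_star T n K1 K0 Km \<longrightarrow> K1 = H1 \<and> K0 = H0 \<and> Km = Hm)
          \<and> maximal_isometric_invariant T H1)"
proof -
  define S where "S = adj UNIV T"
  interpret adjoint_contractions T S
    unfolding S_def by (rule contraction_adjoint_contractions[OF contraction])
  note cnu_S = completely_non_unitary_swap[OF cnu]
  have moments: "defect_moments_degree T S n" by (rule op_polynomial_imp_defect_moments[OF poly])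
  obtain H1 H0 Hm where H: "canonical_rep T n H1 H0 Hm" "maximal_isometric_invariant S Hm"
    using canonical_rep_exists[OF cnu moments] by blast
  obtain G1 G0 Gm where G: "canonical_rep S n G1 G0 Gm" "maximal_isometric_invariant T Gm"
    using adjoint_contractions.canonical_rep_exists[OF swap cnu_S defect_moments_degree_swap[OF moments]]
    by blast
  have "\<exists>H1 H0 Hm. triangular_rep T n H1 H0 Hm" using H(1) unfolding canonical_rep_def by blast
  moreover have "\<exists>H1 H0 Hm. canonical_rep T n H1 H0 Hm
      \<and> (\<forall>K1 K0 Km. canonical_rep T n K1 K0 Km \<longrightarrow> K1 = H1 \<and> K0 = H0 \<and> Km = Hm)
      \<and> maximal_isometric_invariant S Hm"
  proof (rule exI[of _ H1], rule exI[of _ H0], rule exI[of _ Hm], intro conjI H)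
    show "\<forall>K1 K0 Km. canonical_rep T n K1 K0 Km \<longrightarrow> K1 = H1 \<and> K0 = H0 \<and> Km = Hm"
      using canonical_rep_unique[OF H(1)] by blast
  qed
  moreover have "\<exists>H1 H0 Hm. canonical_rep_star T n H1 H0 Hm
      \<and> (\<forall>K1 K0 Km. canonical_rep_star T n K1 K0 Km \<longrightarrow> K1 = H1 \<and> K0 = H0 \<and> Km = Hm)
      \<and> maximal_isometric_invariant T H1"
    unfolding canonical_rep_star_iff[OF cnu]
  proof (rule exI[of _ Gm], rule exI[of _ G0], rule exI[of _ G1], intro conjI G)
    show "\<forall>K1 K0 Km. canonical_rep S n Km K0 K1 \<longrightarrow> K1 = Gm \<and> K0 = G0 \<and> Km = G1"
      using canonical_rep_unique[OF G(1)] by blast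
  qed
  moreover have "\<forall>H1 H0 Hm. triangular_rep T n H1 H0 Hm \<longrightarrow>
      unilateral_shift H1 (entry T H1) \<and> unilateral_shift Hm (adj Hm (entry T Hm))"
    by (intro allI impI conjI triangular_rep_shifts)
  ultimately show ?thesis unfolding S_def by (intro conjI)
qed

end
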